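(* Let $n\ge 1$ be an integer. For every subset $M=\{m_1<\cdots<m_t\}\subseteq[0,n-1]$, with $m_0:=0$ and $m_{t+1}:=n$, $$\sum_{\{\sigma\in B_n\,|\,\mathrm{Des}_B(\sigma^{-1})\subseteq M\}} q^{\ell_B(\sigma)}=\sum_{\{\sigma\in B_n\,|\,\mathrm{Des}_B(\sigma^{-1})\subseteq M\}} q^{\mathrm{fmaj}(\sigma)}=\left[{n \atop \Delta M}\right]_q\cdot\prod_{j=m_1+1}^{n}(1+q^j).$$
   Context: Here $q$ is an indeterminate, $[0,n-1]=\{0,1,\ldots,n-1\}$ and $[\pm n]=\{-n,\ldots,-1,1,\ldots,n\}$. $B_n$ is the hyperoctahedral group: the group (under composition) of all bijections $\sigma$ of $[\pm n]$ with $\sigma(-a)=-\sigma(a)$ for all $a\in[\pm n]$. Write $\sigma=[\sigma(1),\ldots,\sigma(n)]$. $B_n$ is a Coxeter group with generators $s_0=[-1,2,\ldots,n]$ and $s_i=[1,\ldots,i-1,i+1,i,i+2,\ldots,n]$ for $1\le i<n$; $\ell_B(\sigma)$ is the length of $\sigma$, i.e. the minimal $r\in\{0,1,2,\ldots\}$ such that $\sigma=s_{i_1}\cdots s_{i_r}$ for some $i_1,\ldots,i_r\in[0,n-1]$. The $B$-descent set is $\mathrm{Des}_B(\sigma)=\{i\in[0,n-1] : \ell_B(\sigma s_i)<\ell_B(\sigma)\}$ (equivalently, $\{i\in[0,n-1]:\sigma(i)>\sigma(i+1)\}$ with $\sigma(0):=0$). The flag major index is $\mathrm{fmaj}(\sigma)=2\cdot\mathrm{maj}_A(\sigma)+\mathrm{neg}(\sigma)$,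 where $\mathrm{maj}_A(\sigma)=\sum_{\{1\le i\le n-1\,:\,\sigma(i)>\sigma(i+1)\}} i$ (with the usual order $-n<\cdots<-1<1<\cdots<n$) and $\mathrm{neg}(\sigma)=|\{i\in\{1,\ldots,n\}:\sigma(i)<0\}|$. Notation: $[k]_q=\frac{1-q^k}{1-q}$, $[k]_q!=\prod_{i=1}^k[i]_q$, $[0]_q!=1$; for nonnegative integers $n_1+\cdots+n_r=n$, $\left[{n\atop n_1,\ldots,n_r}\right]_q=\frac{[n]_q!}{[n_1]_q!\cdots[n_r]_q!}$; and $\left[{n\atop\Delta M}\right]_q=\left[{n\atop m_1-m_0,\,m_2-m_1,\,\ldots,\,m_{t+1}-m_t}\right]_q$. If $M=\emptyset$ then $t=0$ and $m_1=m_{t+1}=n$; an empty product is $1$. *)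

theory Defs
  imports
    "HOL-Combinatorics.Permutations"
    "HOL-Computational_Algebra.Polynomial_Factorial"
begin

definition pm :: "nat \<Rightarrow> int set" where
  "pm n = {- int n..int n} - {0}"

text \<open>A bijection of \<open>pm n\<close> is extended by the identity to all of \<open>int\<close>, so that
  \<open>\<circ>\<close>, \<open>id\<close> and \<open>inv\<close> are the operations of the group \<open>B\<^sub>n\<close>.\<close>

definition hyperoct :: "nat \<Rightarrow> (int \<Rightarrow> int) set" where
  "hyperoct n = {\<sigma>. \<sigma> permutes pm n \<and> (\<forall>a\<in>pm n. \<sigma> (- a) = - \<sigma> a)}"

definition gen :: "nat \<Rightarrow> int \<Rightarrow> int" where
  "gen i = (if i = 0 then transpose 1 (- 1)
            else transpose (int i) (int i + 1) \<circ> transpose (- int i) (- (int i + 1)))"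

definition word_prod :: "nat list \<Rightarrow> int \<Rightarrow> int" where
  "word_prod w = foldr (\<lambda>i \<tau>. gen i \<circ> \<tau>) w id"

definition len_B :: "nat \<Rightarrow> (int \<Rightarrow> int) \<Rightarrow> nat" where
  "len_B n \<sigma> = (LEAST r. \<exists>w. length w = r \<and> set w \<subseteq> {0..<n} \<and> \<sigma> = word_prod w)"

definition Des_B :: "nat \<Rightarrow> (int \<Rightarrow> int) \<Rightarrow> nat set" where
  "Des_B n \<sigma> = {i \<in> {0..<n}. len_B n (\<sigma> \<circ> gen i) < len_B n \<sigma>}"

definition maj_A :: "nat \<Rightarrow> (int \<Rightarrow> int) \<Rightarrow> nat" where
  "maj_A n \<sigma> = (\<Sum>i | 1 \<le> i \<and> i < n \<and> \<sigma> (int i) > \<sigma> (int i + 1). i)"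

definition neg :: "nat \<Rightarrow> (int \<Rightarrow> int) \<Rightarrow> nat" where
  "neg n \<sigma> = card {i \<in> {1..n}. \<sigma> (int i) < 0}"

definition fmaj :: "nat \<Rightarrow> (int \<Rightarrow> int) \<Rightarrow> nat" where
  "fmaj n \<sigma> = 2 * maj_A n \<sigma> + neg n \<sigma>"

definition q_int :: "'a::field \<Rightarrow> nat \<Rightarrow> 'a" where
  "q_int q k = (1 - q ^ k) / (1 - q)"

definition q_fact :: "'a::field \<Rightarrow> nat \<Rightarrow> 'a" where
  "q_fact q k = (\<Prod>i = 1..k. q_int q i)"

definition q_multinomial :: "'a::field \<Rightarrow> nat \<Rightarrow> nat list \<Rightarrow> 'a" where
  "q_multinomial q n ns = q_fact q n / prod_list (map (q_fact q) ns)"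

text \<open>For \<open>M = {m\<^sub>1 < \<dots> < m\<^sub>t}\<close> contained in \<open>{0..<n}\<close>, \<open>cut_point n M i\<close> is \<open>m\<^sub>i\<close> for
  \<open>0 \<le> i \<le> t + 1\<close>, where \<open>m\<^sub>0 = 0\<close> and \<open>m\<^bsub>t+1\<^esub> = n\<close>; in particular \<open>cut_point n {} 1 = n\<close>.
  The sequence is weakly increasing (\<open>m\<^sub>1\<close> may be \<open>0\<close>), so the differences in \<open>\<Delta>\<close>
  are not truncated.\<close>

definition cut_point :: "nat \<Rightarrow> nat set \<Rightarrow> nat \<Rightarrow> nat" where
  "cut_point n M i = (0 # sorted_list_of_set M @ [n]) ! i"

definition \<Delta> :: "nat \<Rightarrow> nat set \<Rightarrow> nat list" where
  "\<Delta> n M = map (\<lambda>i. cut_point n M (i + 1) - cut_point n M i) [0..<card M + 1]"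

text \<open>The indeterminate, as an element of the field of rational functions in one variable
  (the fraction field of the integer polynomials).\<close>

definition indet :: "int poly fract" where
  "indet = to_fract [:0, 1:]"

end

theory Submission
  imports Defs
begin

text \<open>
  Read a signed permutation as the word \<open>\<sigma>(1) \<dots> \<sigma>(n)\<close>. The condition on \<open>Des\<^sub>B(\<sigma>\<inverse>)\<close> says that
  \<open>\<sigma>\<inverse>\<close> increases on each block of consecutive integers cut out by \<open>M\<close> (the first block, together
  with \<open>0\<close>, being positive), so the last letter \<open>\<sigma>(n)\<close> is determined by its block \<open>b\<close> and its sign:
  it is the maximum of the block or minus its minimum. Index these choices by signed blocks \<open>s\<close>, with
  \<open>s = 0\<close> for the first block, and put \<open>D(s)\<close> for the size of block \<open>\<bar>s\<bar>\<close>, doubled if \<open>s = 0\<close>, and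
  \<open>G(s) = \<Sum>\<^bsub>s' > s\<^esub> D(s')\<close>. If \<open>F\<close> denotes the product on the right-hand side, then removing a letter of
  signed block \<open>s\<close> multiplies \<open>F\<close> by \<open>(1 - q^D(s)) / (1 - q^(2n))\<close>, and
  \<open>q^G(s) (1 - q^D(s)) = q^G(s) - q^G(s-1)\<close> telescopes. The last letter contributes exactly \<open>G(s)\<close> to the
  length, which settles the length sum. For the flag major index, the sum over all words with last
  letter in signed block \<open>s\<close> is again \<open>q^G(s)\<close> times the value of \<open>F\<close> on the remaining letters: this
  follows by induction, splitting the telescoping sum over the last but one letter at \<open>s\<close>.
\<close>

section \<open>Weight sums over signed shuffles\<close>

text \<open>By the recursion each term equals \<open>q ^ f s - q ^ f (s - 1)\<close>, so the sum
  telescopes.\<close>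

lemma sum_diff_power_telescope:
  fixes q :: "'a::comm_ring_1" and f g :: "int \<Rightarrow> nat"
  assumes "l \<le> u" and "\<And>s. f (s - 1) = f s + g s"
  shows "(\<Sum>s\<in>{l+1..u}. q ^ f s * (1 - q ^ g s)) = q ^ f u - q ^ f l"
  using assms(1)
proof (induction l rule: int_le_induct)
  case base
  show ?case by simp
next
  case (step l)
  have "{l - 1 + 1..u} = insert l {l+1..u}" using step.hyps by auto
  then show ?case
    using step.IH assms(2)[of l] by (simp add: algebra_simps power_add)
qed

text \<open>Words are stored reversed, with \<open>\<sigma>(n)\<close> at the head.\<close>

fun fmaj_word :: "int list \<Rightarrow> nat" where
  "fmaj_word [] = 0"
| "fmaj_word (x # u) = fmaj_word u + (if x < 0 then 1 else 0)
     + 2 * (if u \<noteq> [] \<and> hd u > x then length u else 0)"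

text \<open>With \<open>x\<close> in position \<open>n\<close>, the \<open>z\<close> are the values
  at positions \<open>a\<close> with \<open>0 < \<bar>a\<bar> < n\<close>, so the cardinality counts
  the inverted pairs \<open>(a, n)\<close>. The last summand stands for the pair
  \<open>(- n, n)\<close>.\<close>

fun len_word :: "int list \<Rightarrow> nat" where
  "len_word [] = 0"
| "len_word (x # u) = len_word u + card {z \<in> set u \<union> uminus ` set u. z > x}
     + (if x < 0 then 1 else 0)"

lemma prod_Icc_Suc: "(\<Prod>j = 1..Suc m. f j) = (\<Prod>j = 1..m. f j) * f (Suc m)"
  by simp

text \<open>\<open>\<beta> a\<close> is the number of the block containing \<open>a\<close>; block \<open>0\<close> carries no negative letters.\<close>

locale signed_blocks =
  fixes \<beta> :: "int \<Rightarrow> int" and t :: int and q :: "'a::field"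
  assumes mono_\<beta>: "mono \<beta>"
    and \<beta>_bounds: "0 \<le> \<beta> a" "\<beta> a \<le> t"
    and q_power_neq_1: "k > 0 \<Longrightarrow> q ^ k \<noteq> 1"
begin

text \<open>This is monotonicity of the inverse on blocks, read off the word. A negative letter has
  a negative position under the inverse, so reading to the right each new positive letter must lie
  above its block so far, and each new negative letter must lie below it in absolute value.\<close>

fun admissible :: "int list \<Rightarrow> bool" where
  "admissible [] = True"
| "admissible (x # u) \<longleftrightarrow> admissible u \<and> \<bar>x\<bar> \<notin> abs ` set u \<and> (\<beta> \<bar>x\<bar> = 0 \<longrightarrow> x > 0)
     \<and> (\<forall>z\<in>set u. \<beta> \<bar>z\<bar> = \<beta> \<bar>x\<bar> \<longrightarrow> (if x > 0 then \<bar>z\<bar> < x else \<bar>x\<bar> < \<bar>z\<bar>))"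

definition shuffles_of :: "int set \<Rightarrow> int list set" where
  "shuffles_of A = {w. admissible w \<and> abs ` set w = A}"

definition blk :: "int set \<Rightarrow> int \<Rightarrow> int set" where
  "blk A b = {a \<in> A. \<beta> a = b}"

definition letter :: "int set \<Rightarrow> int \<Rightarrow> int" where
  "letter A s = (if 0 \<le> s then Max (blk A s) else - Min (blk A (- s)))"

definition sblk :: "int \<Rightarrow> int" where
  "sblk y = (if y > 0 then \<beta> y else - \<beta> (- y))"

text \<open>Counting \<open>\<beta> a = s\<close> and \<open>- \<beta> a = s\<close> separately makes block \<open>0\<close> count twice.\<close>

definition D :: "int set \<Rightarrow> int \<Rightarrow> nat" where
  "D A s = card {a \<in> A. \<beta> a = s} + card {a \<in> A. - \<beta> a = s}"

definition G :: "int set \<Rightarrow> int \<Rightarrow> nat" where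
  "G A s = card {a \<in> A. \<beta> a > s} + card {a \<in> A. - \<beta> a > s}"

definition block_fact :: "int \<Rightarrow> nat \<Rightarrow> 'a" where
  "block_fact b m = (\<Prod>j = 1..m. 1 - q ^ ((if b = 0 then 2 else 1) * j))"

text \<open>The right-hand side of the theorem after cancelling all powers of \<open>1 - q\<close>:
  since \<open>1 - q ^ (2 * j) = (1 - q ^ j) * (1 + q ^ j)\<close>, the doubled exponents in block 0
  remove the factors \<open>1 + q ^ j\<close> with \<open>j\<close> up to the size of that
  block.\<close>

definition F :: "int set \<Rightarrow> 'a" where
  "F A = (\<Prod>j = 1..card A. 1 - q ^ (2 * j)) / (\<Prod>b\<in>{0..t}. block_fact b (card (blk A b)))"

section \<open>Elementary properties of words and weights\<close>

lemma t_nonneg: "0 \<le> t"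
  using \<beta>_bounds[of 0] by linarith

lemma \<beta>_less_imp_less: "\<beta> a < \<beta> b \<Longrightarrow> a < b"
  using mono_\<beta> by (meson leD leI monoD)

lemma length_admissible: "admissible w \<Longrightarrow> length w = card (abs ` set w)"
  by (induction w) auto

lemma finite_shuffles_of: "finite A \<Longrightarrow> finite (shuffles_of A)"
proof -
  assume A: "finite A"
  have "shuffles_of A \<subseteq> {w. set w \<subseteq> A \<union> uminus ` A \<and> length w = card A}"
  proof
    fix w assume "w \<in> shuffles_of A"
    then have *: "admissible w" "abs ` set w = A" by (auto simp: shuffles_of_def)
    have "x \<in> A \<union> uminus ` A" if "x \<in> set w" for x
    proof -
      have "\<bar>x\<bar> \<in> A" using that * by auto
      moreover have "x = \<bar>x\<bar> \<or> x = - \<bar>x\<bar>" by auto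
      ultimately show ?thesis by (metis UnI1 UnI2 imageI)
    qed
    then show "w \<in> {w. set w \<subseteq> A \<union> uminus ` A \<and> length w = card A}"
      using * length_admissible by auto
  qed
  moreover have "finite {w. set w \<subseteq> A \<union> uminus ` A \<and> length w = card A}"
    using A by (intro finite_lists_length_eq) auto
  ultimately show ?thesis by (rule finite_subset)
qed

lemma shuffles_of_empty: "shuffles_of {} = {[]}"
  by (auto simp: shuffles_of_def)

lemma G_step: assumes "finite A" shows "G A (s - 1) = G A s + D A s"
proof -
  have "{a \<in> A. \<beta> a > s - 1} = {a \<in> A. \<beta> a > s} \<union> {a \<in> A. \<beta> a = s}"
    "{a \<in> A. - \<beta> a > s - 1} = {a \<in> A. - \<beta> a > s} \<union> {a \<in> A. - \<beta> a = s}" by auto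
  then have "card {a \<in> A. \<beta> a > s - 1} = card {a \<in> A. \<beta> a > s} + card {a \<in> A. \<beta> a = s}"
    "card {a \<in> A. - \<beta> a > s - 1} = card {a \<in> A. - \<beta> a > s} + card {a \<in> A. - \<beta> a = s}"
    using assms by (auto intro!: card_Un_disjoint)
  then show ?thesis by (simp add: G_def D_def)
qed

text \<open>Together with \<open>G_bot\<close> this evaluates the telescoping sum over all signed
  blocks to \<open>1 - q ^ (2 * card A)\<close>.\<close>

lemma G_top: "G A t = 0"
proof -
  have 1: "{a \<in> A. \<beta> a > t} = {}" "{a \<in> A. - \<beta> a > t} = {}"
    using \<beta>_bounds t_nonneg by (smt (verit) empty_Collect_eq)+
  show ?thesis unfolding G_def 1 by simp
qed

lemma G_bot: "G A (- t - 1) = 2 * card A"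
proof -
  have "{a \<in> A. \<beta> a > - t - 1} = A" "{a \<in> A. - \<beta> a > - t - 1} = A"
    using \<beta>_bounds t_nonneg by (smt (verit) Collect_cong Collect_mem_eq)+
  then show ?thesis unfolding G_def by simp
qed

lemma D_eq: "D A s = (if s = 0 then 2 else 1) * card (blk A \<bar>s\<bar>)"
proof -
  consider "s = 0" | "s > 0" | "s < 0" by linarith
  then show ?thesis
  proof cases
    case 1 then show ?thesis by (simp add: D_def blk_def)
  next
    case 2
    then have e: "{a \<in> A. - \<beta> a = s} = {}" using \<beta>_bounds by (smt (verit) empty_Collect_eq)
    show ?thesis unfolding D_def e using 2 by (simp add: blk_def)
  next
    case 3
    then have e: "{a \<in> A. \<beta> a = s} = {}" "{a \<in> A. - \<beta> a = s} = blk A \<bar>s\<bar>"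
      using \<beta>_bounds by (smt (verit) empty_Collect_eq) (use 3 in \<open>auto simp: blk_def\<close>)
    show ?thesis unfolding D_def e using 3 by simp
  qed
qed

lemma block_fact_nonzero: "block_fact b m \<noteq> 0"
proof -
  have "1 - q ^ ((if b = 0 then 2 else 1) * j) \<noteq> 0" if "j \<in> {1..m}" for j
    using that q_power_neq_1[of "(if b = 0 then 2 else 1) * j"] by (cases "b = 0") auto
  then show ?thesis unfolding block_fact_def by (subst prod_zero_iff) blast+
qed

lemma block_fact_Suc:
  "block_fact b (Suc m) = block_fact b m * (1 - q ^ ((if b = 0 then 2 else 1) * Suc m))"
  unfolding block_fact_def by (rule prod_Icc_Suc)

text \<open>The numerator loses only its factor for \<open>j = card A\<close>, and the denominator
  only the last factor of the block of \<open>a\<close>, whose exponent is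
  \<open>D A s\<close>.\<close>

lemma F_remove:
  assumes "finite A" "a \<in> A" and s: "\<bar>s\<bar> = \<beta> a"
  shows "F (A - {a}) * (1 - q ^ (2 * card A)) = F A * (1 - q ^ D A s)"
proof -
  define n where "n = card (A - {a})"
  define m where "m = card (blk (A - {a}) (\<beta> a))"
  define R where "R = (\<Prod>b\<in>{0..t} - {\<beta> a}. block_fact b (card (blk A b)))"
  have cA: "card A = Suc n"
    using card.remove[OF assms(1,2)] by (simp only: n_def)
  have "blk A (\<beta> a) = insert a (blk (A - {a}) (\<beta> a))"
    using assms by (auto simp: blk_def)
  then have cb: "card (blk A (\<beta> a)) = Suc m"
    using assms by (simp add: m_def blk_def)
  have other: "blk (A - {a}) b = blk A b" if "b \<noteq> \<beta> a" for b
    using that by (auto simp: blk_def)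
  have mem: "\<beta> a \<in> {0..t}" using \<beta>_bounds by simp
  have p1: "(\<Prod>b\<in>{0..t}. block_fact b (card (blk A b))) = block_fact (\<beta> a) (Suc m) * R"
    unfolding R_def by (subst prod.remove[OF _ mem]) (simp_all only: cb finite_atLeastAtMost_int)
  have p2: "(\<Prod>b\<in>{0..t}. block_fact b (card (blk (A - {a}) b))) = block_fact (\<beta> a) m * R"
    unfolding R_def m_def
    by (subst prod.remove[OF _ mem]) (auto intro!: arg_cong2[where f = times] prod.cong simp: other)
  have R: "R \<noteq> 0" using block_fact_nonzero by (simp add: R_def)
  have "s = 0 \<longleftrightarrow> \<beta> a = 0" using s by (metis abs_eq_0)
  then have D: "D A s = (if \<beta> a = 0 then 2 else 1) * Suc m"
    unfolding D_eq s cb by (simp only:)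
  have q: "block_fact (\<beta> a) (Suc m) = block_fact (\<beta> a) m * (1 - q ^ D A s)"
    unfolding block_fact_Suc D by (rule refl)
  have F1: "F A = (\<Prod>j = 1..n. 1 - q ^ (2 * j)) * (1 - q ^ (2 * card A)) / (block_fact (\<beta> a) (Suc m) * R)"
    unfolding F_def p1 cA prod_Icc_Suc by (rule refl)
  have F2: "F (A - {a}) = (\<Prod>j = 1..n. 1 - q ^ (2 * j)) / (block_fact (\<beta> a) m * R)"
    unfolding F_def p2 n_def by (rule refl)
  have cancel: "P / (b * R) * X = P * X / (b * Y * R) * Y" if "b * Y \<noteq> 0" for P b X Y :: 'a
  proof -
    have "P * X / (b * Y * R) * Y = (P * X) * Y / ((b * R) * Y)" by (simp add: mult_ac)
    also have "\<dots> = P * X / (b * R)" using that by (intro mult_divide_mult_cancel_right) auto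
    finally show ?thesis by simp
  qed
  show ?thesis
    unfolding F1 F2 q by (rule cancel) (use q block_fact_nonzero[of "\<beta> a" "Suc m"] in simp)
qed

section \<open>Choosing and removing the last letter\<close>

lemma letter_props:
  assumes "finite A" "A \<subseteq> {0<..}" "blk A \<bar>s\<bar> \<noteq> {}"
  shows "\<bar>letter A s\<bar> \<in> A" "\<beta> \<bar>letter A s\<bar> = \<bar>s\<bar>" "sblk (letter A s) = s"
    and "letter A s > 0 \<longleftrightarrow> s \<ge> 0" "letter A s < 0 \<longleftrightarrow> s < 0"
    and "\<And>z. z \<in> A \<Longrightarrow> \<beta> z = \<bar>s\<bar> \<Longrightarrow> s \<ge> 0 \<Longrightarrow> z \<le> letter A s"
    and "\<And>z. z \<in> A \<Longrightarrow> \<beta> z = \<bar>s\<bar> \<Longrightarrow> s < 0 \<Longrightarrow> - letter A s \<le> z"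
proof -
  have fin: "finite (blk A \<bar>s\<bar>)" using assms by (simp add: blk_def)
  have mx: "Max (blk A \<bar>s\<bar>) \<in> blk A \<bar>s\<bar>" and mn: "Min (blk A \<bar>s\<bar>) \<in> blk A \<bar>s\<bar>"
    using fin assms by auto
  have pos: "x > 0" if "x \<in> blk A b" for x b using that assms by (auto simp: blk_def)
  have l: "if s \<ge> 0 then letter A s = Max (blk A \<bar>s\<bar>) else letter A s = - Min (blk A \<bar>s\<bar>)"
    by (simp add: letter_def)
  show sg: "letter A s > 0 \<longleftrightarrow> s \<ge> 0" "letter A s < 0 \<longleftrightarrow> s < 0"
    using l pos[OF mx] pos[OF mn] by (auto split: if_splits)
  have in_blk: "\<bar>letter A s\<bar> \<in> blk A \<bar>s\<bar>"
    using l mx mn pos[OF mx] pos[OF mn] by (auto split: if_splits)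
  then show "\<bar>letter A s\<bar> \<in> A" and b: "\<beta> \<bar>letter A s\<bar> = \<bar>s\<bar>" by (auto simp: blk_def)
  show "sblk (letter A s) = s" using b sg by (auto simp: sblk_def split: if_splits)
  show "\<And>z. z \<in> A \<Longrightarrow> \<beta> z = \<bar>s\<bar> \<Longrightarrow> s \<ge> 0 \<Longrightarrow> z \<le> letter A s"
    using l fin by (simp add: blk_def)
  show "\<And>z. z \<in> A \<Longrightarrow> \<beta> z = \<bar>s\<bar> \<Longrightarrow> s < 0 \<Longrightarrow> - letter A s \<le> z"
    using l fin by (simp add: blk_def)
qed

text \<open>The signed blocks that can supply a last letter. For an empty block,
  \<open>letter\<close> would refer to the maximum or minimum of the empty set.\<close>

definition sblks :: "int set \<Rightarrow> int set" where
  "sblks A = {s \<in> {- t..t}. blk A \<bar>s\<bar> \<noteq> {}}"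

lemma finite_sblks: "finite (sblks A)"
  by (rule finite_subset[of _ "{- t..t}"]) (auto simp: sblks_def)

definition rest :: "int set \<Rightarrow> int \<Rightarrow> int set" where
  "rest A s = A - {\<bar>letter A s\<bar>}"

lemma sblk_bounds: "sblk y \<in> {- t..t}"
  using \<beta>_bounds[of y] \<beta>_bounds[of "- y"] by (auto simp: sblk_def)

text \<open>If \<open>x\<close> were not the extreme element of its block, that element would occur
  up to sign in \<open>u\<close>, and admissibility would force \<open>x\<close> beyond it.
  Conversely, extremality of \<open>x\<close> yields every inequality that admissibility demands of
  it.\<close>

lemma Cons_in_shuffles_of:
  assumes "finite A" "A \<subseteq> {0<..}"
  shows "x # u \<in> shuffles_of A \<longleftrightarrow>
    sblk x \<in> sblks A \<and> x = letter A (sblk x) \<and> u \<in> shuffles_of (rest A (sblk x))"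
proof
  assume L: "x # u \<in> shuffles_of A"
  then have adm: "admissible (x # u)" and A: "A = insert \<bar>x\<bar> (abs ` set u)"
    by (auto simp: shuffles_of_def)
  have x: "\<bar>x\<bar> > 0" using A assms by auto
  have b: "\<bar>sblk x\<bar> = \<beta> \<bar>x\<bar>" using \<beta>_bounds(1)[of "\<bar>x\<bar>"] x by (auto simp: sblk_def)
  have inb: "\<bar>x\<bar> \<in> blk A \<bar>sblk x\<bar>" using A b by (auto simp: blk_def)
  then have ne: "blk A \<bar>sblk x\<bar> \<noteq> {}" by auto
  note lp = letter_props[OF assms ne]
  have sg: "sblk x \<ge> 0 \<longleftrightarrow> x > 0"
    using adm \<beta>_bounds(1)[of "\<bar>x\<bar>"] x by (auto simp: sblk_def)
  have "x = letter A (sblk x)"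
  proof (rule ccontr)
    assume neq: "x \<noteq> letter A (sblk x)"
    have lin: "\<bar>letter A (sblk x)\<bar> \<noteq> \<bar>x\<bar>" using neq sg lp(4,5) by (auto simp: abs_if split: if_splits)
    then obtain z where z: "z \<in> set u" "\<bar>z\<bar> = \<bar>letter A (sblk x)\<bar>"
      using lp(1) A by (metis image_iff insert_iff)
    have "if x > 0 then \<bar>z\<bar> < x else \<bar>x\<bar> < \<bar>z\<bar>"
      using adm z lp(2) b by auto
    then show False
      using z lp(4,5) lp(6)[of "\<bar>x\<bar>"] lp(7)[of "\<bar>x\<bar>"] inb sg by (auto simp: blk_def split: if_splits)
  qed
  moreover have "u \<in> shuffles_of (rest A (sblk x))"
    using adm A calculation[symmetric] by (auto simp: shuffles_of_def rest_def)
  ultimately show "sblk x \<in> sblks A \<and> x = letter A (sblk x) \<and> u \<in> shuffles_of (rest A (sblk x))"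
    using ne sblk_bounds by (auto simp: sblks_def)
next
  assume R: "sblk x \<in> sblks A \<and> x = letter A (sblk x) \<and> u \<in> shuffles_of (rest A (sblk x))"
  define s where "s = sblk x"
  have ne: "blk A \<bar>s\<bar> \<noteq> {}" and x: "letter A s = x" and adm: "admissible u"
    and A: "abs ` set u = A - {\<bar>x\<bar>}"
    using R by (auto simp: sblks_def s_def shuffles_of_def rest_def)
  note lp = letter_props[OF assms ne, unfolded x]
  have "(if x > 0 then \<bar>z\<bar> < x else \<bar>x\<bar> < \<bar>z\<bar>)" if z: "z \<in> set u" "\<beta> \<bar>z\<bar> = \<beta> \<bar>x\<bar>" for z
  proof -
    have "\<bar>z\<bar> \<in> A" "\<bar>z\<bar> \<noteq> \<bar>x\<bar>" using A z by auto
    then show ?thesis using lp(2,4,5) lp(6)[of "\<bar>z\<bar>"] lp(7)[of "\<bar>z\<bar>"] z(2) by auto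
  qed
  moreover have "x > 0" if "\<beta> \<bar>x\<bar> = 0" using that lp(2,4) by auto
  ultimately show "x # u \<in> shuffles_of A"
    using adm A lp(1) by (auto simp: shuffles_of_def)
qed

lemma sum_shuffles_of:
  assumes "finite A" "A \<subseteq> {0<..}" "A \<noteq> {}"
  shows "(\<Sum>w\<in>shuffles_of A. f w)
    = (\<Sum>s\<in>sblks A. \<Sum>u\<in>shuffles_of (rest A s). f (letter A s # u))"
proof -
  have fin: "finite (shuffles_of (rest A s))" for s
    using assms finite_shuffles_of by (simp add: rest_def)
  have lp: "sblk (letter A s) = s" if "s \<in> sblks A" for s
    using that letter_props(3)[OF assms(1,2)] by (simp add: sblks_def)
  have "(\<Sum>w\<in>shuffles_of A. f w)
    = (\<Sum>(s, u)\<in>Sigma (sblks A) (\<lambda>s. shuffles_of (rest A s)). f (letter A s # u))"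
  proof (rule sum.reindex_bij_witness[where j = "\<lambda>w. (sblk (hd w), tl w)"
        and i = "\<lambda>(s, u). letter A s # u"])
    fix w assume w: "w \<in> shuffles_of A"
    then obtain x u where "w = x # u"
      using assms(3) by (cases w) (auto simp: shuffles_of_def)
    then have c: "sblk x \<in> sblks A \<and> x = letter A (sblk x) \<and> u \<in> shuffles_of (rest A (sblk x))"
      using w Cons_in_shuffles_of[OF assms(1,2)] by blast
    show "(case (sblk (hd w), tl w) of (s, u) \<Rightarrow> letter A s # u) = w"
      "(sblk (hd w), tl w) \<in> Sigma (sblks A) (\<lambda>s. shuffles_of (rest A s))"
      "(case (sblk (hd w), tl w) of (s, u) \<Rightarrow> f (letter A s # u)) = f w"
      using c \<open>w = x # u\<close> by auto
  next
    fix p assume "p \<in> Sigma (sblks A) (\<lambda>s. shuffles_of (rest A s))"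
    then show "(sblk (hd (case p of (s, u) \<Rightarrow> letter A s # u)), tl (case p of (s, u) \<Rightarrow> letter A s # u)) = p"
      "(case p of (s, u) \<Rightarrow> letter A s # u) \<in> shuffles_of A"
      using lp Cons_in_shuffles_of[OF assms(1,2)] by auto
  qed
  also have "\<dots> = (\<Sum>s\<in>sblks A. \<Sum>u\<in>shuffles_of (rest A s). f (letter A s # u))"
    by (rule sum.Sigma[symmetric]) (use fin finite_sblks in auto)
  finally show ?thesis .
qed

section \<open>Telescoping over the choice of the last letter\<close>

lemma rest_props:
  assumes "finite A" "A \<subseteq> {0<..}" "s \<in> sblks A"
  shows "finite (rest A s)" "rest A s \<subseteq> {0<..}" "card A = Suc (card (rest A s))"
    and "F (rest A s) * (1 - q ^ (2 * card A)) = F A * (1 - q ^ D A s)"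
proof -
  have ne: "blk A \<bar>s\<bar> \<noteq> {}" using assms by (simp add: sblks_def)
  note lp = letter_props[OF assms(1,2) ne]
  show "finite (rest A s)" "rest A s \<subseteq> {0<..}" using assms by (auto simp: rest_def)
  show "card A = Suc (card (rest A s))" unfolding rest_def by (rule card.remove[OF assms(1) lp(1)])
  show "F (rest A s) * (1 - q ^ (2 * card A)) = F A * (1 - q ^ D A s)"
    using F_remove[OF assms(1) lp(1)] lp(2) by (simp add: rest_def)
qed

text \<open>\<open>F_remove\<close> turns the terms into telescoping differences. Indices of empty
  blocks can be added freely, because there \<open>D A s = 0\<close>. Partial intervals are allowed
  so that the flag major index sum can be split at a signed block.\<close>

lemma sum_sblks:
  assumes "finite A" "A \<subseteq> {0<..}" "- t - 1 \<le> l" "l \<le> u" "u \<le> t"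
  shows "(\<Sum>s\<in>sblks A \<inter> {l+1..u}. q ^ G A s * F (rest A s)) * (1 - q ^ (2 * card A))
    = (q ^ G A u - q ^ G A l) * F A"
proof -
  have "(\<Sum>s\<in>sblks A \<inter> {l+1..u}. q ^ G A s * F (rest A s)) * (1 - q ^ (2 * card A))
    = (\<Sum>s\<in>sblks A \<inter> {l+1..u}. q ^ G A s * (1 - q ^ D A s) * F A)"
    unfolding sum_distrib_right
    by (rule sum.cong) (use rest_props(4)[OF assms(1,2)] in \<open>auto simp: mult.assoc\<close>)
  also have "\<dots> = (\<Sum>s\<in>{l+1..u}. q ^ G A s * (1 - q ^ D A s) * F A)"
  proof (rule sum.mono_neutral_left)
    show "\<forall>i\<in>{l + 1..u} - sblks A \<inter> {l + 1..u}. q ^ G A i * (1 - q ^ D A i) * F A = 0"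
      using assms by (auto simp: sblks_def D_eq)
  qed auto
  also have "\<dots> = (q ^ G A u - q ^ G A l) * F A"
    using sum_diff_power_telescope[of l u "G A" "D A" q] assms G_step
    by (simp flip: sum_distrib_right)
  finally show ?thesis .
qed

lemma q_power_card_neq_1: "finite A \<Longrightarrow> A \<noteq> {} \<Longrightarrow> 1 - q ^ (2 * card A) \<noteq> 0"
  using q_power_neq_1[of "2 * card A"] by (simp add: card_gt_0_iff)

lemma sum_sblks_all:
  assumes "finite A" "A \<subseteq> {0<..}" "A \<noteq> {}"
  shows "(\<Sum>s\<in>sblks A. q ^ G A s * F (rest A s)) = F A"
proof -
  have "sblks A \<inter> {- t - 1 + 1..t} = sblks A" by (auto simp: sblks_def)
  then have "(\<Sum>s\<in>sblks A. q ^ G A s * F (rest A s)) * (1 - q ^ (2 * card A))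
    = F A * (1 - q ^ (2 * card A))"
    using sum_sblks[OF assms(1,2), of "- t - 1" t] t_nonneg G_top G_bot by simp
  then show ?thesis using q_power_card_neq_1[OF assms(1,3)] by simp
qed

section \<open>Generating functions of the flag major index and the length\<close>

lemma F_empty: "F {} = 1"
  by (simp add: F_def blk_def block_fact_def)

text \<open>The removed letter has block number \<open>\<bar>s\<bar>\<close>. Of the two conditions
  \<open>\<bar>s\<bar> > s\<close> and \<open>- \<bar>s\<bar> > s\<close> counted by
  \<open>G\<close>, only the first can hold, and it does so exactly for negative
  \<open>s\<close>.\<close>

lemma G_rest:
  assumes "finite A" "A \<subseteq> {0<..}" "s \<in> sblks A"
  shows "G A s = G (rest A s) s + (if letter A s < 0 then 1 else 0)"
proof -
  have ne: "blk A \<bar>s\<bar> \<noteq> {}" using assms by (simp add: sblks_def)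
  note lp = letter_props[OF assms(1,2) ne]
  let ?a = "\<bar>letter A s\<bar>"
  have 1: "{a \<in> A. - \<beta> a > s} = {a \<in> rest A s. - \<beta> a > s}"
    using lp(2) by (auto simp: rest_def)
  show ?thesis
  proof (cases "s < 0")
    case True
    then have "{a \<in> A. \<beta> a > s} = insert ?a {a \<in> rest A s. \<beta> a > s}"
      using lp(1,2) by (auto simp: rest_def)
    then have "card {a \<in> A. \<beta> a > s} = Suc (card {a \<in> rest A s. \<beta> a > s})"
      using assms by (simp add: rest_def)
    then show ?thesis using 1 True lp(5) by (simp add: G_def)
  next
    case False
    then have "{a \<in> A. \<beta> a > s} = {a \<in> rest A s. \<beta> a > s}"
      using lp(2) by (auto simp: rest_def)
    then show ?thesis using 1 False lp(5) by (simp add: G_def)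
  qed
qed

text \<open>For \<open>s' = s\<close> the letter already removed was the largest available in its
  signed block, so no larger one remains. Otherwise the signs decide, or the monotonicity of \<beta>
  does.\<close>

lemma letter_rest_gt_iff:
  assumes "finite A" "A \<subseteq> {0<..}" "s \<in> sblks A" "s' \<in> sblks (rest A s)"
  shows "letter (rest A s) s' > letter A s \<longleftrightarrow> s' > s"
proof -
  note r = rest_props[OF assms(1-3)]
  have ne: "blk A \<bar>s\<bar> \<noteq> {}" "blk (rest A s) \<bar>s'\<bar> \<noteq> {}" using assms by (auto simp: sblks_def)
  note lp = letter_props[OF assms(1,2) ne(1)]
  note lp' = letter_props[OF r(1,2) ne(2)]
  let ?x = "letter A s" and ?y = "letter (rest A s) s'"
  have y: "\<bar>?y\<bar> \<in> A" "\<bar>?y\<bar> \<noteq> \<bar>?x\<bar>" using lp'(1) by (auto simp: rest_def)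
  consider "s' = s" | "s' \<ge> 0 \<and> s \<ge> 0 \<and> s' \<noteq> s" | "s' < 0 \<and> s < 0 \<and> s' \<noteq> s" | "s' < 0 \<and> s \<ge> 0" | "s' \<ge> 0 \<and> s < 0"
    by linarith
  then show ?thesis
  proof cases
    case 1
    have "\<not> ?y > ?x"
    proof (cases "s \<ge> 0")
      case True
      then have "\<bar>?y\<bar> \<le> ?x" using lp(6)[OF y(1)] lp'(2) 1 by simp
      then show ?thesis by linarith
    next
      case False
      then have "- ?x \<le> \<bar>?y\<bar>" "?y < 0" using lp(7)[OF y(1)] lp'(2,5) 1 by auto
      then show ?thesis by linarith
    qed
    then show ?thesis using 1 by simp
  next
    case 2
    then have "\<beta> ?x = s" "\<beta> ?y = s'" using lp lp' by auto
    then show ?thesis using \<beta>_less_imp_less[of ?x ?y] \<beta>_less_imp_less[of ?y ?x] 2 by linarith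
  next
    case 3
    then have "\<beta> (- ?x) = - s" "\<beta> (- ?y) = - s'" using lp(2,5) lp'(2,5) by auto
    then show ?thesis using \<beta>_less_imp_less[of "- ?x" "- ?y"] \<beta>_less_imp_less[of "- ?y" "- ?x"] 3 by linarith
  qed (use lp(4,5) lp'(4,5) in linarith)+
qed

text \<open>The refinement by the last letter is what the induction needs: a descent at the last position
  occurs exactly if the last but one letter lies in a larger signed block.\<close>

lemma sum_fmaj_word_letter:
  assumes "finite A" "A \<subseteq> {0<..}" "s \<in> sblks A"
  shows "(\<Sum>u\<in>shuffles_of (rest A s). q ^ fmaj_word (letter A s # u)) = q ^ G A s * F (rest A s)"
  using assms
proof (induction "card A" arbitrary: A s rule: less_induct)
  case less
  define B where "B = rest A s"
  define x where "x = letter A s"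
  define e where "e = (if x < 0 then 1 else 0 :: nat)"
  note r = rest_props[OF less.prems, folded B_def]
  have Ge: "G A s = G B s + e" using G_rest[OF less.prems] by (simp add: B_def x_def e_def)
  show ?case
  proof (cases "B = {}")
    case True
    then show ?thesis
      using Ge by (simp add: shuffles_of_empty F_empty G_def flip: B_def x_def e_def)
  next
    case False
    \<comment> \<open>A descent in front of the last letter sits at position \<open>card B\<close>,
      which the flag major index counts twice.\<close>
    define c where "c s' = (if s' > s then q ^ (2 * card B) else 1)" for s'
    have "(\<Sum>u\<in>shuffles_of B. q ^ fmaj_word (x # u)) =
      (\<Sum>s'\<in>sblks B. \<Sum>u\<in>shuffles_of (rest B s'). q ^ fmaj_word (x # letter B s' # u))"
      by (rule sum_shuffles_of[OF r(1,2) False])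
    also have "\<dots> = (\<Sum>s'\<in>sblks B. q ^ e * c s' * (q ^ G B s' * F (rest B s')))"
    proof (rule sum.cong[OF refl])
      fix s' assume s': "s' \<in> sblks B"
      have "q ^ fmaj_word (x # letter B s' # u) = q ^ e * c s' * q ^ fmaj_word (letter B s' # u)"
        if "u \<in> shuffles_of (rest B s')" for u
      proof -
        have "length u = card (rest B s')"
          using that length_admissible by (auto simp: shuffles_of_def)
        then have "Suc (length u) = card B"
          using rest_props(3)[OF r(1,2) s'] by simp
        moreover have "x < letter B s' \<longleftrightarrow> s < s'"
          using letter_rest_gt_iff[OF less.prems] s' by (simp add: B_def x_def)
        ultimately show ?thesis
          by (subst fmaj_word.simps(2))
             (simp add: c_def e_def power_add mult.commute del: fmaj_word.simps(2))
      qed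
      then have "(\<Sum>u\<in>shuffles_of (rest B s'). q ^ fmaj_word (x # letter B s' # u)) =
        q ^ e * c s' * (\<Sum>u\<in>shuffles_of (rest B s'). q ^ fmaj_word (letter B s' # u))"
        by (simp add: sum_distrib_left del: fmaj_word.simps)
      also have "(\<Sum>u\<in>shuffles_of (rest B s'). q ^ fmaj_word (letter B s' # u))
          = q ^ G B s' * F (rest B s')"
        using less.hyps[of B s'] r s' by simp
      finally show "(\<Sum>u\<in>shuffles_of (rest B s'). q ^ fmaj_word (x # letter B s' # u)) =
        q ^ e * c s' * (q ^ G B s' * F (rest B s'))" .
    qed
    also have "\<dots> = q ^ e * (\<Sum>s'\<in>sblks B. c s' * (q ^ G B s' * F (rest B s')))"
      by (simp add: sum_distrib_left mult.assoc)
    also have "(\<Sum>s'\<in>sblks B. c s' * (q ^ G B s' * F (rest B s'))) = q ^ G B s * F B"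
    proof -
      have st: "- t \<le> s" "s \<le> t" using less.prems by (auto simp: sblks_def)
      define N where "N = 1 - q ^ (2 * card B)"
      \<comment> \<open>Times \<open>N\<close>, the part without descent telescopes to
        \<open>q ^ G B s - q ^ (2 * card B)\<close> and the other to \<open>1 - q ^ G B s\<close>,
        each times \<open>F B\<close>. Weighting the second by \<open>q ^ (2 * card B)\<close>
        cancels the constant terms and leaves \<open>q ^ G B s * N\<close>.\<close>
      define S1 S2 where "S1 = (\<Sum>s'\<in>sblks B \<inter> {- t - 1 + 1..s}. q ^ G B s' * F (rest B s'))"
        and "S2 = (\<Sum>s'\<in>sblks B \<inter> {s + 1..t}. q ^ G B s' * F (rest B s'))"
      have "sblks B = (sblks B \<inter> {- t - 1 + 1..s}) \<union> (sblks B \<inter> {s+1..t})"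
        by (auto simp: sblks_def)
      then have "(\<Sum>s'\<in>sblks B. c s' * (q ^ G B s' * F (rest B s')))
        = (\<Sum>s'\<in>(sblks B \<inter> {- t - 1 + 1..s}) \<union> (sblks B \<inter> {s+1..t}). c s' * (q ^ G B s' * F (rest B s')))"
        by simp
      also have "\<dots> = (\<Sum>s'\<in>sblks B \<inter> {- t - 1 + 1..s}. c s' * (q ^ G B s' * F (rest B s')))
          + (\<Sum>s'\<in>sblks B \<inter> {s + 1..t}. c s' * (q ^ G B s' * F (rest B s')))"
        by (rule sum.union_disjoint) (auto simp: finite_sblks)
      also have "\<dots> = S1 + q ^ (2 * card B) * S2"
        by (simp add: S1_def S2_def sum_distrib_left c_def)
      finally have e1: "(\<Sum>s'\<in>sblks B. c s' * (q ^ G B s' * F (rest B s'))) = S1 + q ^ (2 * card B) * S2" .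
      have "S1 * N = (q ^ G B s - q ^ (2 * card B)) * F B"
        unfolding S1_def N_def using sum_sblks[OF r(1,2), of "- t - 1" s] st G_bot[of B] by simp
      moreover have "S2 * N = (1 - q ^ G B s) * F B"
        unfolding S2_def N_def using sum_sblks[OF r(1,2), of s t] st G_top[of B] by simp
      ultimately have "(S1 + q ^ (2 * card B) * S2) * N
          = (q ^ G B s - q ^ (2 * card B)) * F B + q ^ (2 * card B) * ((1 - q ^ G B s) * F B)"
        by (simp only: distrib_right mult.assoc)
      also have "\<dots> = q ^ G B s * F B * N" by (simp add: N_def algebra_simps)
      finally show ?thesis
        unfolding e1 using q_power_card_neq_1[OF r(1) False] by (simp add: N_def)
    qed
    finally show ?thesis
      by (simp add: Ge power_add flip: B_def x_def)
  qed
qed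

theorem sum_fmaj_word:
  assumes "finite A" "A \<subseteq> {0<..}"
  shows "(\<Sum>w\<in>shuffles_of A. q ^ fmaj_word w) = F A"
proof (cases "A = {}")
  case False
  have "(\<Sum>w\<in>shuffles_of A. q ^ fmaj_word w) = (\<Sum>s\<in>sblks A. q ^ G A s * F (rest A s))"
    unfolding sum_shuffles_of[OF assms False]
    by (rule sum.cong[OF refl], rule sum_fmaj_word_letter[OF assms])
  then show ?thesis
    unfolding sum_sblks_all[OF assms False] .
qed (simp add: shuffles_of_empty F_empty)

text \<open>Adjoining the negatives erases the signs in \<open>u\<close>, so the inversions of the
  last letter depend only on the remaining absolute values. As the last letter is extreme in its
  block, comparing values with it amounts to comparing block numbers, which is what \<open>G\<close>
  counts.\<close>

lemma len_word_letter:
  assumes "finite A" "A \<subseteq> {0<..}" "s \<in> sblks A" "u \<in> shuffles_of (rest A s)"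
  shows "len_word (letter A s # u) = G A s + len_word u"
proof -
  have ne: "blk A \<bar>s\<bar> \<noteq> {}" using assms by (simp add: sblks_def)
  note lp = letter_props[OF assms(1,2) ne]
  note r = rest_props[OF assms(1-3)]
  define B where "B = rest A s"
  define x where "x = letter A s"
  have u: "abs ` set u = B" using assms by (simp add: shuffles_of_def B_def)
  have sym: "set u \<union> uminus ` set u = B \<union> uminus ` B"
  proof -
    have 1: "z \<in> set u \<union> uminus ` set u \<longleftrightarrow> \<bar>z\<bar> \<in> abs ` set u" for z
    proof
      assume "\<bar>z\<bar> \<in> abs ` set u"
      then obtain y where "y \<in> set u" "z = y \<or> z = - y" by (auto simp: abs_eq_iff)
      then show "z \<in> set u \<union> uminus ` set u" by auto
    qed (auto intro: rev_image_eqI)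
    have 2: "z \<in> B \<union> uminus ` B \<longleftrightarrow> \<bar>z\<bar> \<in> B" for z
    proof
      assume "\<bar>z\<bar> \<in> B"
      then show "z \<in> B \<union> uminus ` B" by (cases "z \<ge> 0") (auto intro: rev_image_eqI)
    next
      assume "z \<in> B \<union> uminus ` B"
      then show "\<bar>z\<bar> \<in> B" using r(2) by (auto simp: B_def subset_iff)
    qed
    show ?thesis by (rule set_eqI) (simp only: 1 2 u)
  qed
  have cmp: "\<beta> a > \<beta> \<bar>x\<bar> \<longleftrightarrow> a > \<bar>x\<bar>" if "a \<in> B" "s \<ge> 0" for a
  proof -
    have "a \<in> A" "a \<noteq> \<bar>x\<bar>" using that by (auto simp: B_def rest_def x_def)
    then show ?thesis using that lp(2,4) lp(6)[of a] \<beta>_less_imp_less[of a "\<bar>x\<bar>"] \<beta>_less_imp_less[of "\<bar>x\<bar>" a]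
      by (cases "\<beta> a" "\<beta> \<bar>x\<bar>" rule: linorder_cases) (simp_all add: x_def)
  qed
  have cmp': "\<beta> a < \<beta> \<bar>x\<bar> \<longleftrightarrow> a < \<bar>x\<bar>" if "a \<in> B" "s < 0" for a
  proof -
    have "a \<in> A" "a \<noteq> \<bar>x\<bar>" using that by (auto simp: B_def rest_def x_def)
    then show ?thesis using that lp(2,5) lp(7)[of a] \<beta>_less_imp_less[of a "\<bar>x\<bar>"] \<beta>_less_imp_less[of "\<bar>x\<bar>" a]
      by (cases "\<beta> a" "\<beta> \<bar>x\<bar>" rule: linorder_cases) (simp_all add: x_def)
  qed
  have pos: "a > 0" if "a \<in> B" for a using that r(2) by (auto simp: B_def)
  have "card {z \<in> B \<union> uminus ` B. z > x} = G B s"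
  proof (cases "s \<ge> 0")
    case True
    have x: "x > 0" "\<beta> \<bar>x\<bar> = s" using True lp by (auto simp: x_def)
    have 1: "{z \<in> B \<union> uminus ` B. z > x} = {a \<in> B. \<beta> a > s}"
      using cmp[OF _ True] x by (auto dest: pos)
    have 2: "{a \<in> B. - \<beta> a > s} = {}" using True \<beta>_bounds(1) by (smt (verit) empty_Collect_eq)
    show ?thesis unfolding G_def 1 2 by simp
  next
    case False
    have x: "x < 0" "\<beta> \<bar>x\<bar> = - s" using False lp by (auto simp: x_def)
    \<comment> \<open>All of \<open>B\<close> exceeds the negative \<open>x\<close>, so only the
      negated elements need a comparison.\<close>
    have 0: "{z \<in> B \<union> uminus ` B. z > x} = B \<union> uminus ` {a \<in> B. - \<beta> a > s}"
    proof -
      have "{a \<in> B. - \<beta> a > s} = {a \<in> B. a < - x}"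
      proof (rule Collect_cong, rule conj_cong[OF refl])
        fix a assume "a \<in> B"
        then have "\<beta> a < - s \<longleftrightarrow> a < - x" using cmp'[of a] False x by simp
        then show "- \<beta> a > s \<longleftrightarrow> a < - x" by linarith
      qed
      moreover have "z > x" if "z \<in> B" for z using pos[OF that] x by linarith
      moreover have "{z \<in> uminus ` B. z > x} = uminus ` {a \<in> B. a < - x}"
        by (auto simp: minus_less_iff)
      ultimately show ?thesis by blast
    qed
    have 1: "{a \<in> B. \<beta> a > s} = B" using False \<beta>_bounds(1) by (smt (verit) Collect_cong Collect_mem_eq)
    have "False" if "y \<in> B" "- y \<in> B" for y using pos[OF that(1)] pos[OF that(2)] by simp
    then have 2: "B \<inter> uminus ` {a \<in> B. - \<beta> a > s} = {}" by blast
    have "finite B" using r(1) by (simp add: B_def)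
    then show ?thesis unfolding 0 G_def 1
      using 2 by (simp add: card_Un_disjoint card_image)
  qed
  then show ?thesis
    using G_rest[OF assms(1-3)] sym by (simp add: B_def x_def)
qed

theorem sum_len_word:
  assumes "finite A" "A \<subseteq> {0<..}"
  shows "(\<Sum>w\<in>shuffles_of A. q ^ len_word w) = F A"
  using assms
proof (induction "card A" arbitrary: A rule: less_induct)
  case less
  show ?case
  proof (cases "A = {}")
    case False
    have "(\<Sum>u\<in>shuffles_of (rest A s). q ^ len_word (letter A s # u)) = q ^ G A s * F (rest A s)"
      if s: "s \<in> sblks A" for s
    proof -
      note r = rest_props[OF less.prems s]
      have "(\<Sum>u\<in>shuffles_of (rest A s). q ^ len_word (letter A s # u)) =
        (\<Sum>u\<in>shuffles_of (rest A s). q ^ G A s * q ^ len_word u)"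
        using len_word_letter[OF less.prems s]
        by (intro sum.cong refl) (simp add: power_add del: len_word.simps)
      also have "\<dots> = q ^ G A s * F (rest A s)"
        using less.hyps[of "rest A s"] r by (simp flip: sum_distrib_left)
      finally show ?thesis .
    qed
    then have "(\<Sum>w\<in>shuffles_of A. q ^ len_word w) = (\<Sum>s\<in>sblks A. q ^ G A s * F (rest A s))"
      unfolding sum_shuffles_of[OF less.prems False] by (rule sum.cong[OF refl])
    then show ?thesis
      unfolding sum_sblks_all[OF less.prems False] .
  qed (simp add: shuffles_of_empty F_empty)
qed

end

section \<open>Length and descents in the hyperoctahedral group\<close>

lemma gen_apply:
  "gen i a = (if i = 0 then (if a = 1 then - 1 else if a = - 1 then 1 else a)
    else if a = int i then int i + 1 else if a = int i + 1 then int i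
    else if a = - int i then - int i - 1 else if a = - int i - 1 then - int i else a)"
  by (auto simp: gen_def transpose_def)

lemma gen_minus: "gen i (- a) = - gen i a"
  by (auto simp: gen_apply)

lemma gen_gen: "gen i (gen i a) = a"
  by (auto simp: gen_apply)

lemma gen_comp_gen: "gen i \<circ> gen i = id"
  by (auto simp: gen_gen)

lemma gen_eq_0_iff: "gen i a = 0 \<longleftrightarrow> a = 0"
  by (auto simp: gen_apply)

lemma gen_abs_le: "i < n \<Longrightarrow> \<bar>a\<bar> \<le> int n \<Longrightarrow> \<bar>gen i a\<bar> \<le> int n"
  by (auto simp: gen_apply)

lemma mem_pm: "a \<in> pm n \<longleftrightarrow> a \<noteq> 0 \<and> \<bar>a\<bar> \<le> int n"
  by (auto simp: pm_def)

lemma gen_in_hyperoct: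
  assumes "i < n" shows "gen i \<in> hyperoct n"
proof -
  have "gen i permutes pm n"
  proof (rule bij_imp_permutes)
    show "bij_betw (gen i) (pm n) (pm n)"
      by (rule bij_betwI[where g = "gen i"])
         (use assms gen_abs_le in \<open>auto simp: mem_pm gen_eq_0_iff gen_gen\<close>)
    fix x assume "x \<notin> pm n"
    then show "gen i x = x" using assms by (auto simp: gen_apply mem_pm)
  qed
  then show ?thesis by (simp add: hyperoct_def gen_minus)
qed

lemma hyperoct_id: "id \<in> hyperoct n"
  by (simp add: hyperoct_def permutes_id)

lemma hyperoct_minus: "\<sigma> \<in> hyperoct n \<Longrightarrow> \<sigma> (- a) = - \<sigma> a"
  by (cases "a \<in> pm n") (auto simp: hyperoct_def permutes_def mem_pm)

lemma hyperoct_0: "\<sigma> \<in> hyperoct n \<Longrightarrow> \<sigma> 0 = 0"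
  using hyperoct_minus[of \<sigma> n 0] by simp

lemma hyperoct_inj: "\<sigma> \<in> hyperoct n \<Longrightarrow> inj \<sigma>"
  by (auto simp: hyperoct_def permutes_inj)

lemma hyperoct_permutes: "\<sigma> \<in> hyperoct n \<Longrightarrow> \<sigma> permutes pm n"
  by (simp add: hyperoct_def)

lemma hyperoct_comp:
  assumes "\<sigma> \<in> hyperoct n" "\<tau> \<in> hyperoct n" shows "\<sigma> \<circ> \<tau> \<in> hyperoct n"
  using assms hyperoct_minus[OF assms(1)] hyperoct_minus[OF assms(2)]
  by (simp add: hyperoct_def permutes_compose)

lemma hyperoct_inv:
  assumes "\<sigma> \<in> hyperoct n" shows "inv \<sigma> \<in> hyperoct n"
proof -
  have p: "\<sigma> permutes pm n" using assms by (rule hyperoct_permutes)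
  have "inv \<sigma> (- a) = - inv \<sigma> a" for a
  proof -
    have "\<sigma> (- inv \<sigma> a) = - a"
      using hyperoct_minus[OF assms] permutes_inverses(1)[OF p] by simp
    then show ?thesis using permutes_inverses(2)[OF p] by metis
  qed
  then show ?thesis using permutes_inv[OF p] by (simp add: hyperoct_def)
qed

text \<open>The positive roots of type B, as the pairs \<open>(a, b)\<close> with \<open>\<bar>a\<bar> \<le> b\<close>: one representative
  of each orbit of pairs \<open>a < b\<close> under \<open>(a, b) \<mapsto> (- b, - a)\<close>.\<close>

definition pos_roots :: "nat \<Rightarrow> (int \<times> int) set" where
  "pos_roots n = {(a, b). 1 \<le> b \<and> b \<le> int n \<and> - b \<le> a \<and> a < b \<and> a \<noteq> 0}"

text \<open>For a signed permutation these are the positive roots sent to negative ones; their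
  number turns out to be the Coxeter length.\<close>

definition invs :: "nat \<Rightarrow> (int \<Rightarrow> int) \<Rightarrow> (int \<times> int) set" where
  "invs n \<sigma> = {(a, b) \<in> pos_roots n. \<sigma> a > \<sigma> b}"

text \<open>For \<open>i = 0\<close> the pair \<open>(- 1, 1)\<close> replaces
  \<open>(0, 1)\<close>: by oddness, \<sigma> inverts it exactly if
  \<open>\<sigma> 1 < 0 = \<sigma> 0\<close>.\<close>

definition simple_root :: "nat \<Rightarrow> int \<times> int" where
  "simple_root i = (if i = 0 then (- 1, 1) else (int i, int i + 1))"

text \<open>The image pair under \<open>gen i\<close>, moved if necessary to the orbit
  representative whose second entry dominates in absolute value.\<close>

definition gen_root :: "nat \<Rightarrow> int \<times> int \<Rightarrow> int \<times> int" where
  "gen_root i = (\<lambda>(a, b). if \<bar>gen i a\<bar> \<le> gen i b then (gen i a, gen i b) else (- gen i b, - gen i a))"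

section \<open>Inversions under multiplication by a generator\<close>

lemma finite_pos_roots: "finite (pos_roots n)"
  by (rule finite_subset[of _ "{- int n..int n} \<times> {- int n..int n}"]) (auto simp: pos_roots_def)

lemma finite_invs: "finite (invs n \<sigma>)"
  by (rule finite_subset[OF _ finite_pos_roots[of n]]) (auto simp: invs_def)

lemma simple_root_in_pos_roots: "i < n \<Longrightarrow> simple_root i \<in> pos_roots n"
  by (auto simp: simple_root_def pos_roots_def)

text \<open>A generator interchanges neighbouring nonzero integers and so reverses only the pairs it
  interchanges. Among these, \<open>(- i - 1, - i)\<close> is no positive root, which leaves the
  simple root.\<close>

lemma gen_less_gen:
  assumes "(a, b) \<in> pos_roots n" "(a, b) \<noteq> simple_root i"
  shows "gen i a < gen i b"
proof (cases "i = 0")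
  case True
  have "b = 1 \<Longrightarrow> a = - 1" using assms(1) by (auto simp: pos_roots_def)
  then have "b > 1" using assms True by (auto simp: simple_root_def pos_roots_def)
  then show ?thesis using assms(1) True by (auto simp: gen_apply pos_roots_def)
next
  case False
  then have i: "int i \<ge> 1" by simp
  have "a < b" "b \<ge> 1" "a \<noteq> 0" "\<not> (a = int i \<and> b = int i + 1)"
    using assms False by (auto simp: simple_root_def pos_roots_def)
  moreover have "gen i b = (if b = int i then int i + 1 else if b = int i + 1 then int i else b)"
    using False \<open>b \<ge> 1\<close> by (auto simp: gen_apply)
  moreover have "gen i a \<le> a + 1" "a \<noteq> int i \<Longrightarrow> a > 0 \<Longrightarrow> gen i a \<le> a" "a < 0 \<Longrightarrow> gen i a < 0"
    using False i by (auto simp: gen_apply)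
  ultimately show ?thesis using i
    by (smt (verit))
qed

text \<open>A simple reflection permutes the positive roots other than its own.\<close>

lemma gen_root_props:
  assumes i: "i < n" and p: "p \<in> pos_roots n - {simple_root i}"
  shows "gen_root i p \<in> pos_roots n - {simple_root i}" "gen_root i (gen_root i p) = p"
proof -
  obtain a b where ab: "p = (a, b)" by (cases p)
  have r: "1 \<le> b" "b \<le> int n" "- b \<le> a" "a < b" "a \<noteq> 0" "(a, b) \<noteq> simple_root i"
    using p by (auto simp: ab pos_roots_def)
  define x y where "x = gen i a" and "y = gen i b"
  have xy: "x < y" using gen_less_gen[of a b n i] p by (simp add: ab x_def y_def)
  have nz: "x \<noteq> 0" "y \<noteq> 0" using r by (auto simp: x_def y_def gen_eq_0_iff)
  have bd: "\<bar>x\<bar> \<le> int n" "\<bar>y\<bar> \<le> int n"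
    using r i gen_abs_le[of i n] by (auto simp: x_def y_def)
  have gen_xy: "gen i x = a" "gen i y = b" by (simp_all add: x_def y_def gen_gen)
  have g: "gen_root i p = (if \<bar>x\<bar> \<le> y then (x, y) else (- y, - x))"
    by (simp add: gen_root_def ab x_def y_def)
  have mem: "gen_root i p \<in> pos_roots n"
    using xy nz bd unfolding g pos_roots_def by auto
  have "(x, y) \<noteq> simple_root i"
    using gen_xy r(1-5) by (auto simp: simple_root_def gen_apply split: if_splits)
  moreover have "(- y, - x) \<noteq> simple_root i"
  proof
    assume e: "(- y, - x) = simple_root i"
    have "b = - gen i (- y)" using gen_xy by (simp add: gen_minus)
    moreover have "gen i (- y) > 0"
      using e by (auto simp: simple_root_def gen_apply split: if_splits)
    ultimately show False using r by auto
  qed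
  ultimately show "gen_root i p \<in> pos_roots n - {simple_root i}" using mem g by auto
  show "gen_root i (gen_root i p) = p"
  proof (cases "\<bar>x\<bar> \<le> y")
    case True
    moreover have "\<bar>a\<bar> \<le> b" using r by auto
    ultimately show ?thesis unfolding g by (simp add: gen_root_def gen_xy ab)
  next
    case False
    \<comment> \<open>The second application has to flip back; its test \<open>b \<le> - a\<close>
      could succeed only for \<open>a = - b\<close>.\<close>
    have "a \<noteq> - b"
    proof
      assume "a = - b"
      then have "x = - y" by (simp add: x_def y_def gen_minus)
      then show False using False xy by simp
    qed
    then have "\<not> b \<le> - a" using r by simp
    then show ?thesis using False r unfolding g by (simp add: gen_root_def gen_xy ab gen_minus)
  qed
qed

text \<open>The involution \<open>gen_root i\<close> matches the two sets: flipping a pair to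
  \<open>(- b, - a)\<close> does not affect being inverted, because \<sigma> is odd.\<close>

lemma card_invs_comp_gen_remove:
  assumes s: "\<sigma> \<in> hyperoct n" and i: "i < n"
  shows "card (invs n (\<sigma> \<circ> gen i) - {simple_root i}) = card (invs n \<sigma> - {simple_root i})"
proof -
  have eq: "gen_root i p \<in> invs n \<sigma> \<longleftrightarrow> p \<in> invs n (\<sigma> \<circ> gen i)"
    "gen_root i p \<in> invs n (\<sigma> \<circ> gen i) \<longleftrightarrow> p \<in> invs n \<sigma>"
    if p: "p \<in> pos_roots n - {simple_root i}" for p
  proof -
    obtain a b where ab: "p = (a, b)" by (cases p)
    have "gen_root i p \<in> pos_roots n" "p \<in> pos_roots n"
      using gen_root_props(1)[OF i p] p by auto
    then show "gen_root i p \<in> invs n \<sigma> \<longleftrightarrow> p \<in> invs n (\<sigma> \<circ> gen i)"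
      "gen_root i p \<in> invs n (\<sigma> \<circ> gen i) \<longleftrightarrow> p \<in> invs n \<sigma>"
      by (auto simp: invs_def ab gen_root_def hyperoct_minus[OF s] gen_minus gen_gen split: if_splits)
  qed
  have "bij_betw (gen_root i) (invs n (\<sigma> \<circ> gen i) - {simple_root i}) (invs n \<sigma> - {simple_root i})"
  proof (rule bij_betwI[where g = "gen_root i"])
    have sub: "p \<in> pos_roots n - {simple_root i}" if "p \<in> invs n \<tau> - {simple_root i}" for p \<tau>
      using that by (auto simp: invs_def)
    show "gen_root i \<in> invs n (\<sigma> \<circ> gen i) - {simple_root i} \<rightarrow> invs n \<sigma> - {simple_root i}"
      "gen_root i \<in> invs n \<sigma> - {simple_root i} \<rightarrow> invs n (\<sigma> \<circ> gen i) - {simple_root i}"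
      using eq gen_root_props(1)[OF i] sub by blast+
    show "gen_root i (gen_root i p) = p" if "p \<in> invs n (\<sigma> \<circ> gen i) - {simple_root i}" for p
      using gen_root_props(2)[OF i] sub[OF that] .
    show "gen_root i (gen_root i p) = p" if "p \<in> invs n \<sigma> - {simple_root i}" for p
      using gen_root_props(2)[OF i] sub[OF that] .
  qed
  then show ?thesis by (rule bij_betw_same_card)
qed

lemma simple_root_in_invs_iff:
  assumes s: "\<sigma> \<in> hyperoct n" and i: "i < n"
  shows "simple_root i \<in> invs n \<sigma> \<longleftrightarrow> \<sigma> (int i) > \<sigma> (int i + 1)"
    and "simple_root i \<in> invs n (\<sigma> \<circ> gen i) \<longleftrightarrow> \<not> \<sigma> (int i) > \<sigma> (int i + 1)"
proof -
  have m: "simple_root i \<in> pos_roots n" using i by (rule simple_root_in_pos_roots)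
  have 0: "\<sigma> 0 = 0" "\<sigma> (- 1) = - \<sigma> 1" using hyperoct_0[OF s] hyperoct_minus[OF s] by auto
  show "simple_root i \<in> invs n \<sigma> \<longleftrightarrow> \<sigma> (int i) > \<sigma> (int i + 1)"
    using m 0 by (auto simp: invs_def simple_root_def)
  have ne: "\<sigma> (int i) \<noteq> \<sigma> (int i + 1)" using injD[OF hyperoct_inj[OF s], of "int i" "int i + 1"] by auto
  show "simple_root i \<in> invs n (\<sigma> \<circ> gen i) \<longleftrightarrow> \<not> \<sigma> (int i) > \<sigma> (int i + 1)"
    using m 0 ne by (auto simp: invs_def simple_root_def gen_apply)
qed

lemma card_invs_comp_gen:
  assumes s: "\<sigma> \<in> hyperoct n" and i: "i < n"
  shows "\<sigma> (int i) > \<sigma> (int i + 1) \<Longrightarrow> card (invs n \<sigma>) = Suc (card (invs n (\<sigma> \<circ> gen i)))"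
    and "\<not> \<sigma> (int i) > \<sigma> (int i + 1) \<Longrightarrow> card (invs n (\<sigma> \<circ> gen i)) = Suc (card (invs n \<sigma>))"
proof -
  note c = card_invs_comp_gen_remove[OF s i] and e = simple_root_in_invs_iff[OF s i]
  show "\<sigma> (int i) > \<sigma> (int i + 1) \<Longrightarrow> card (invs n \<sigma>) = Suc (card (invs n (\<sigma> \<circ> gen i)))"
    using card.remove[OF finite_invs, of "simple_root i" n \<sigma>] c e by simp
  show "\<not> \<sigma> (int i) > \<sigma> (int i + 1) \<Longrightarrow> card (invs n (\<sigma> \<circ> gen i)) = Suc (card (invs n \<sigma>))"
    using card.remove[OF finite_invs, of "simple_root i" n "\<sigma> \<circ> gen i"] c e by simp
qed

text \<open>Strict increase from \<open>\<sigma> 0 = 0\<close> gives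
  \<open>\<sigma> k \<ge> k\<close>, and strict increase up to \<open>\<sigma> n \<le> n\<close>
  gives \<open>\<sigma> k \<le> k\<close>.\<close>

lemma no_descent_imp_id:
  assumes s: "\<sigma> \<in> hyperoct n" and "\<And>i. i < n \<Longrightarrow> \<not> \<sigma> (int i) > \<sigma> (int i + 1)"
  shows "\<sigma> = id"
proof -
  have lt: "\<sigma> (int i) < \<sigma> (int i + 1)" if "i < n" for i
  proof -
    have "\<sigma> (int i) \<noteq> \<sigma> (int i + 1)" using injD[OF hyperoct_inj[OF s], of "int i" "int i + 1"] by auto
    then show ?thesis using assms(2)[OF that] by linarith
  qed
  have lo: "k \<le> n \<Longrightarrow> int k \<le> \<sigma> (int k)" for k
  proof (induction k)
    case 0 then show ?case using hyperoct_0[OF s] by simp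
  next
    case (Suc k) then show ?case using lt[of k] by (simp add: add.commute)
  qed
  have hi: "\<sigma> (int (n - d)) \<le> int (n - d)" if "d \<le> n" for d
    using that
  proof (induction d)
    case 0
    have "\<sigma> (int n) \<le> int n"
    proof (cases "n = 0")
      case False
      then have "int n \<in> pm n" by (simp add: mem_pm)
      then have "\<sigma> (int n) \<in> pm n" using permutes_in_image[OF hyperoct_permutes[OF s]] by blast
      then show ?thesis by (auto simp: mem_pm)
    qed (use hyperoct_0[OF s] in simp)
    then show ?case by simp
  next
    case (Suc d)
    have "int (n - d) = int (n - Suc d) + 1" using Suc.prems by simp
    then show ?case using lt[of "n - Suc d"] Suc by simp
  qed
  have nn: "\<sigma> (int k) = int k" if "k \<le> n" for k
    using lo[OF that] hi[of "n - k"] that by simp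
  have "\<sigma> a = a" for a
  proof (cases "a \<in> pm n")
    case True
    then have k: "nat \<bar>a\<bar> \<le> n" by (auto simp: mem_pm)
    then have "\<sigma> \<bar>a\<bar> = \<bar>a\<bar>" using nn[OF k] by simp
    then show ?thesis using hyperoct_minus[OF s, of a] by (cases "a \<ge> 0") auto
  next
    case False
    then show ?thesis using hyperoct_permutes[OF s] by (simp add: permutes_def)
  qed
  then show ?thesis by auto
qed

section \<open>Coxeter length as the number of inversions\<close>

lemma invs_id: "invs n id = {}"
  by (auto simp: invs_def pos_roots_def)

lemma word_prod_append: "word_prod (w @ [i]) = word_prod w \<circ> gen i"
  by (induction w) (auto simp: word_prod_def comp_assoc)

lemma word_prod_in_hyperoct: "set w \<subseteq> {0..<n} \<Longrightarrow> word_prod w \<in> hyperoct n"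
proof (induction w rule: rev_induct)
  case Nil then show ?case using hyperoct_id by (simp add: word_prod_def id_def)
next
  case (snoc i w)
  then have "word_prod w \<in> hyperoct n" "i < n" by auto
  then show ?case unfolding word_prod_append by (intro hyperoct_comp gen_in_hyperoct)
qed

lemma card_invs_word_prod_le: "set w \<subseteq> {0..<n} \<Longrightarrow> card (invs n (word_prod w)) \<le> length w"
proof (induction w rule: rev_induct)
  case Nil then show ?case by (simp add: word_prod_def invs_id flip: id_def)
next
  case (snoc i w)
  then have "word_prod w \<in> hyperoct n" "i < n" by (auto intro: word_prod_in_hyperoct)
  note c = card_invs_comp_gen[OF this]
  have "card (invs n (word_prod w \<circ> gen i)) \<le> Suc (card (invs n (word_prod w)))"
    using c by (cases "word_prod w (int i) > word_prod w (int i + 1)") simp_all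
  also have "\<dots> \<le> length (w @ [i])" using snoc by simp
  finally show ?case unfolding word_prod_append .
qed

text \<open>Sorting: as long as a descent exists, multiplying by its generator removes exactly one
  inversion, and only the identity has no descent.\<close>

lemma exists_word:
  "\<sigma> \<in> hyperoct n \<Longrightarrow> \<exists>w. length w = card (invs n \<sigma>) \<and> set w \<subseteq> {0..<n} \<and> \<sigma> = word_prod w"
proof (induction "card (invs n \<sigma>)" arbitrary: \<sigma> rule: less_induct)
  case less
  show ?case
  proof (cases "\<sigma> = id")
    case True
    then show ?thesis by (intro exI[of _ "[]"]) (simp add: invs_id word_prod_def)
  next
    case False
    then obtain i where i: "i < n" "\<sigma> (int i) > \<sigma> (int i + 1)"
      using no_descent_imp_id[OF less.prems] by blast
    have c: "card (invs n \<sigma>) = Suc (card (invs n (\<sigma> \<circ> gen i)))"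
      using card_invs_comp_gen(1)[OF less.prems i] .
    have h: "\<sigma> \<circ> gen i \<in> hyperoct n" using less.prems i by (simp add: hyperoct_comp gen_in_hyperoct)
    obtain w where w: "length w = card (invs n (\<sigma> \<circ> gen i))" "set w \<subseteq> {0..<n}" "\<sigma> \<circ> gen i = word_prod w"
      using less.hyps[OF _ h] c by auto
    have "\<sigma> = word_prod (w @ [i])"
      unfolding word_prod_append w(3)[symmetric] by (simp add: comp_assoc gen_comp_gen)
    then show ?thesis using w c i by (intro exI[of _ "w @ [i]"]) simp
  qed
qed

theorem len_B_eq: "\<sigma> \<in> hyperoct n \<Longrightarrow> len_B n \<sigma> = card (invs n \<sigma>)"
  unfolding len_B_def
  by (rule Least_equality) (use exists_word card_invs_word_prod_le in auto)

theorem Des_B_eq: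
  assumes "\<sigma> \<in> hyperoct n"
  shows "Des_B n \<sigma> = {i. i < n \<and> \<sigma> (int i) > \<sigma> (int i + 1)}"
proof -
  have "len_B n (\<sigma> \<circ> gen i) < len_B n \<sigma> \<longleftrightarrow> \<sigma> (int i) > \<sigma> (int i + 1)" if "i < n" for i
    using card_invs_comp_gen[OF assms that] assms that
    by (cases "\<sigma> (int i) > \<sigma> (int i + 1)") (simp_all add: len_B_eq hyperoct_comp gen_in_hyperoct)
  then show ?thesis by (auto simp: Des_B_def)
qed

section \<open>The statistics read off the word\<close>

primrec rev_word :: "(int \<Rightarrow> int) \<Rightarrow> nat \<Rightarrow> int list" where
  "rev_word \<sigma> 0 = []"
| "rev_word \<sigma> (Suc n) = \<sigma> (int (Suc n)) # rev_word \<sigma> n"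

lemma length_rev_word [simp]: "length (rev_word \<sigma> n) = n"
  by (induction n) auto

lemma set_rev_word: "set (rev_word \<sigma> n) = \<sigma> ` {1..int n}"
proof (induction n)
  case (Suc n)
  have "{1..int (Suc n)} = insert (int (Suc n)) {1..int n}" by auto
  then show ?case using Suc by simp
qed simp

lemma fmaj_eq_fmaj_word: "fmaj n \<sigma> = fmaj_word (rev_word \<sigma> n)"
proof (induction n)
  case 0 then show ?case by (simp add: fmaj_def maj_A_def neg_def)
next
  case (Suc n)
  have "{i \<in> {1..Suc n}. \<sigma> (int i) < 0} = {i \<in> {1..n}. \<sigma> (int i) < 0} \<union>
      (if \<sigma> (int (Suc n)) < 0 then {Suc n} else {})"
    by (auto simp: le_Suc_eq)
  then have neg: "neg (Suc n) \<sigma> = neg n \<sigma> + (if \<sigma> (int (Suc n)) < 0 then 1 else 0)"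
    by (simp add: neg_def card_insert_if)
  have "{i. 1 \<le> i \<and> i < Suc n \<and> \<sigma> (int i) > \<sigma> (int i + 1)}
    = {i. 1 \<le> i \<and> i < n \<and> \<sigma> (int i) > \<sigma> (int i + 1)}
      \<union> (if n \<ge> 1 \<and> \<sigma> (int n) > \<sigma> (int n + 1) then {n} else {})"
    by (auto simp: less_Suc_eq)
  then have maj: "maj_A (Suc n) \<sigma> = maj_A n \<sigma> + (if n \<ge> 1 \<and> \<sigma> (int n) > \<sigma> (int n + 1) then n else 0)"
    by (simp add: maj_A_def)
  have "rev_word \<sigma> n \<noteq> [] \<longleftrightarrow> n \<ge> 1" "n \<ge> 1 \<Longrightarrow> hd (rev_word \<sigma> n) = \<sigma> (int n)"
    by (cases n; simp)+
  then show ?case using Suc neg maj by (auto simp: fmaj_def add.commute)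
qed

text \<open>Passing from \<open>n\<close> to \<open>Suc n\<close> adds only the pairs with second
  entry \<open>Suc n\<close>. The hypotheses do not mention \<open>n\<close>, because
  \<open>n\<close> varies in the induction while \<sigma> is fixed.\<close>

lemma card_invs_eq_len_word:
  assumes "inj \<sigma>" and odd: "\<And>a. \<sigma> (- a) = - \<sigma> a"
  shows "card (invs n \<sigma>) = len_word (rev_word \<sigma> n)"
proof (induction n)
  case 0
  have "invs 0 \<sigma> = {}" by (auto simp: invs_def pos_roots_def)
  then show ?case by simp
next
  case (Suc n)
  let ?m = "int (Suc n)"
  define X where "X = {a \<in> pm n. \<sigma> a > \<sigma> ?m}"
  define Y where "Y = (if \<sigma> ?m < 0 then {- ?m} else {})"
  have "(a, b) \<in> invs (Suc n) \<sigma> \<longleftrightarrow> (a, b) \<in> invs n \<sigma> \<union> (\<lambda>a. (a, ?m)) ` (X \<union> Y)" for a b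
  proof (cases "b = ?m")
    case True
    have "(a, ?m) \<in> invs (Suc n) \<sigma> \<longleftrightarrow> a \<in> X \<union> Y"
      using odd[of ?m] by (cases "a = - ?m") (auto simp: invs_def pos_roots_def X_def Y_def mem_pm)
    moreover have "(a, ?m) \<notin> invs n \<sigma>" by (auto simp: invs_def pos_roots_def)
    ultimately show ?thesis using True by auto
  qed (auto simp: invs_def pos_roots_def)
  then have eq: "invs (Suc n) \<sigma> = invs n \<sigma> \<union> (\<lambda>a. (a, ?m)) ` (X \<union> Y)" by (auto simp: set_eq_iff)
  have finX: "finite X" by (rule finite_subset[of _ "pm n"]) (auto simp: X_def pm_def)
  have "X \<inter> Y = {}" by (auto simp: X_def Y_def mem_pm)
  then have "card ((\<lambda>a. (a, ?m)) ` (X \<union> Y)) = card X + card Y"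
    using finX by (subst card_image) (auto simp: inj_on_def card_Un_disjoint Y_def)
  moreover have "invs n \<sigma> \<inter> (\<lambda>a. (a, ?m)) ` (X \<union> Y) = {}"
    by (auto simp: invs_def pos_roots_def)
  ultimately have c: "card (invs (Suc n) \<sigma>) = card (invs n \<sigma>) + (card X + card Y)"
    unfolding eq using finX finite_invs by (subst card_Un_disjoint) (auto simp: Y_def)
  have pm: "pm n = {1..int n} \<union> uminus ` {1..int n}"
    by (auto simp: pm_def)
  have "\<sigma> ` uminus ` {1..int n} = uminus ` \<sigma> ` {1..int n}"
    unfolding image_image odd ..
  then have im: "\<sigma> ` pm n = set (rev_word \<sigma> n) \<union> uminus ` set (rev_word \<sigma> n)"
    by (simp only: pm image_Un set_rev_word)
  have "\<sigma> ` X = {z \<in> \<sigma> ` pm n. z > \<sigma> ?m}"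
    unfolding X_def by blast
  then have "\<sigma> ` X = {z \<in> set (rev_word \<sigma> n) \<union> uminus ` set (rev_word \<sigma> n). z > \<sigma> ?m}"
    unfolding im .
  moreover have "card (\<sigma> ` X) = card X"
    using assms(1) by (intro card_image) (auto simp: inj_on_def)
  ultimately have "card {z \<in> set (rev_word \<sigma> n) \<union> uminus ` set (rev_word \<sigma> n). z > \<sigma> ?m} = card X"
    by simp
  then show ?case using Suc c by (simp add: Y_def)
qed

section \<open>Inverse descent classes as sets of words\<close>

text \<open>Applied to the sorted cuts, this converts a bound on a block number into a comparison
  with one cut point.\<close>

lemma card_less_le_iff:
  fixes xs :: "'a::linorder list"
  assumes "sorted_wrt (<) xs"
  shows "card {m \<in> set xs. m < a} \<le> b \<longleftrightarrow> length xs \<le> b \<or> a \<le> xs ! b"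
  using assms
proof (induction xs arbitrary: b)
  case (Cons x xs)
  show ?case
  proof (cases "a \<le> x")
    case True
    then have e: "{m \<in> set (x # xs). m < a} = {}" using Cons.prems by auto
    have "a \<le> (x # xs) ! b" if "b < length (x # xs)"
      using nth_mem[OF that] Cons.prems True by auto
    then show ?thesis unfolding e by (cases "b < length (x # xs)") auto
  next
    case False
    have "{m \<in> set (x # xs). m < a} = insert x {m \<in> set xs. m < a}" using False by auto
    moreover have "x \<notin> set xs" using Cons.prems by auto
    ultimately have "card {m \<in> set (x # xs). m < a} = Suc (card {m \<in> set xs. m < a})" by simp
    then show ?thesis using False Cons by (cases b) auto
  qed
qed simp

section \<open>The indeterminate and q-factorials\<close>

lemma to_fract_power: "to_fract (p ^ k) = to_fract p ^ k"
  by (induction k) simp_all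

lemma indet_power_neq_1: "k > 0 \<Longrightarrow> indet ^ k \<noteq> 1"
proof
  assume k: "k > 0" and "indet ^ k = 1"
  then have "to_fract (monom 1 k :: int poly) = to_fract 1"
    by (simp add: indet_def monom_altdef to_fract_power)
  then have "(monom 1 k :: int poly) = 1" by (simp only: to_fract_eq_iff)
  then have "degree (monom (1::int) k) = degree (1 :: int poly)" by simp
  then show False using k by (simp add: degree_monom_eq)
qed

lemma prod_one_minus_power_double:
  fixes q :: "'a::comm_ring_1"
  shows "(\<Prod>j = 1..m. 1 - q ^ (2 * j)) = (\<Prod>j = 1..m. 1 - q ^ j) * (\<Prod>j = 1..m. 1 + q ^ j)"
proof -
  have "1 - q ^ (2 * j) = (1 - q ^ j) * (1 + q ^ j)" for j
    unfolding mult_2 power_add by (simp add: algebra_simps)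
  then show ?thesis by (simp add: prod.distrib)
qed

lemma q_fact_eq: "q_fact q m = (\<Prod>j = 1..m. 1 - q ^ j) / (1 - q) ^ m"
  by (simp add: q_fact_def q_int_def prod_dividef)

section \<open>Signed permutations as words\<close>

lemma nth_rev_word: "k < n \<Longrightarrow> rev_word \<sigma> n ! k = \<sigma> (int (n - k))"
proof (induction n arbitrary: k)
  case (Suc n)
  then show ?case by (cases k) auto
qed simp

lemma inj_on_rev_word: "inj_on (\<lambda>\<sigma>. rev_word \<sigma> n) (hyperoct n)"
proof (rule inj_onI, rule ext)
  fix \<sigma> \<tau> a assume s: "\<sigma> \<in> hyperoct n" "\<tau> \<in> hyperoct n" and e: "rev_word \<sigma> n = rev_word \<tau> n"
  have pos: "\<sigma> (int k) = \<tau> (int k)" if "1 \<le> k" "k \<le> n" for k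
    using nth_rev_word[of "n - k" n \<sigma>] nth_rev_word[of "n - k" n \<tau>] that e by simp
  show "\<sigma> a = \<tau> a"
  proof (cases "a \<in> pm n")
    case True
    then have "1 \<le> nat \<bar>a\<bar>" "nat \<bar>a\<bar> \<le> n" by (auto simp: mem_pm)
    then have "\<sigma> \<bar>a\<bar> = \<tau> \<bar>a\<bar>" using pos[of "nat \<bar>a\<bar>"] by simp
    then show ?thesis using hyperoct_minus[OF s(1), of a] hyperoct_minus[OF s(2), of a]
      by (cases "a \<ge> 0") auto
  next
    case False
    then show ?thesis using s by (simp add: hyperoct_def permutes_def)
  qed
qed

lemma hyperoct_inverse:
  assumes "\<sigma> \<in> hyperoct n" shows "inv \<sigma> (\<sigma> a) = a" "\<sigma> (inv \<sigma> a) = a"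
  using permutes_inverses[OF hyperoct_permutes[OF assms]] by auto

lemma hyperoct_abs:
  assumes "\<sigma> \<in> hyperoct n" "a \<in> {1..int n}" shows "\<bar>\<sigma> a\<bar> \<in> {1..int n}"
proof -
  have "a \<in> pm n" using assms by (auto simp: mem_pm)
  then have "\<sigma> a \<in> pm n" using permutes_in_image[OF hyperoct_permutes[OF assms(1)]] by blast
  then show ?thesis by (auto simp: mem_pm)
qed

lemma inv_abs:
  assumes s: "\<sigma> \<in> hyperoct n" and a: "a > 0"
  shows "inv \<sigma> \<bar>\<sigma> a\<bar> = (if \<sigma> a > 0 then a else - a)"
  using hyperoct_inverse[OF s] hyperoct_minus[OF hyperoct_inv[OF s], of "\<sigma> a"]
  by auto

lemma abs_set_rev_word:
  assumes s: "\<sigma> \<in> hyperoct n" shows "abs ` set (rev_word \<sigma> n) = {1..int n}"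
proof -
  have "c \<in> abs ` \<sigma> ` {1..int n}" if c: "c \<in> {1..int n}" for c
  proof -
    have "\<bar>\<sigma> \<bar>inv \<sigma> c\<bar>\<bar> = c"
      using hyperoct_inverse(2)[OF s, of c] hyperoct_minus[OF s, of "inv \<sigma> c"] c
      by (cases "inv \<sigma> c \<ge> 0") auto
    then show ?thesis using hyperoct_abs[OF hyperoct_inv[OF s] c] by (metis image_eqI)
  qed
  then show ?thesis using hyperoct_abs[OF s] by (auto simp: set_rev_word)
qed

lemma exists_hyperoct_rev_word:
  assumes d: "distinct (map abs w)" and A: "abs ` set w = {1..int n}"
  obtains \<sigma> where "\<sigma> \<in> hyperoct n" "rev_word \<sigma> n = w"
proof -
  have len: "length w = n"
    using distinct_card[OF d] A by simp
  \<comment> \<open>The word is reversed, so position \<open>\<bar>a\<bar>\<close> has index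
    \<open>n - \<bar>a\<bar>\<close>; the factor \<open>sgn a\<close> makes the function
    odd.\<close>
  define \<sigma> where "\<sigma> a = (if a \<in> pm n then sgn a * w ! nat (int n - \<bar>a\<bar>) else a)" for a
  have idx: "nat (int n - \<bar>a\<bar>) < n" if "a \<in> pm n" for a using that by (auto simp: mem_pm)
  have ab: "\<bar>\<sigma> a\<bar> = \<bar>w ! nat (int n - \<bar>a\<bar>)\<bar>" if "a \<in> pm n" for a
    using that by (auto simp: \<sigma>_def abs_mult mem_pm)
  have rng: "\<bar>\<sigma> a\<bar> \<in> {1..int n}" if "a \<in> pm n" for a
    using idx[OF that] len A unfolding ab[OF that] by (metis image_eqI nth_mem)
  have odd: "\<sigma> (- a) = - \<sigma> a" for a
    by (auto simp: \<sigma>_def mem_pm)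
  have "inj_on \<sigma> (pm n)"
  proof (rule inj_onI)
    fix a b assume a: "a \<in> pm n" and b: "b \<in> pm n" and e: "\<sigma> a = \<sigma> b"
    have "map abs w ! nat (int n - \<bar>a\<bar>) = map abs w ! nat (int n - \<bar>b\<bar>)"
      using e ab[OF a] ab[OF b] idx[OF a] idx[OF b] len by simp
    then have "nat (int n - \<bar>a\<bar>) = nat (int n - \<bar>b\<bar>)"
      using d idx[OF a] idx[OF b] len by (subst (asm) nth_eq_iff_index_eq) auto
    then have "\<bar>a\<bar> = \<bar>b\<bar>" using a b by (auto simp: mem_pm)
    moreover have "a \<noteq> - b"
    proof
      assume "a = - b"
      then have "\<sigma> b = 0" using e odd[of b] by simp
      then show False using rng[OF b] by simp
    qed
    ultimately show "a = b" by (auto simp: abs_eq_iff)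
  qed
  moreover have "\<sigma> ` pm n \<subseteq> pm n" using rng by (force simp: mem_pm)
  ultimately have "bij_betw \<sigma> (pm n) (pm n)"
    by (simp add: bij_betw_def endo_inj_surj pm_def)
  then have "\<sigma> permutes pm n" by (rule bij_imp_permutes) (simp add: \<sigma>_def)
  then have "\<sigma> \<in> hyperoct n" using odd by (simp add: hyperoct_def)
  moreover have "rev_word \<sigma> n = w"
    by (rule nth_equalityI) (auto simp: len nth_rev_word \<sigma>_def mem_pm)
  ultimately show ?thesis by (rule that)
qed

section \<open>Inverse descents and admissibility\<close>

context signed_blocks
begin

lemma admissible_imp_distinct: "admissible w \<Longrightarrow> distinct (map abs w)"
  by (induction w) auto

text \<open>The distinctness clause of \<open>admissible\<close> disappears, since an odd injection
  takes different absolute values at different positive positions.\<close>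

lemma admissible_rev_word_iff:
  assumes s: "\<sigma> \<in> hyperoct n"
  shows "admissible (rev_word \<sigma> k) \<longleftrightarrow> (\<forall>j\<in>{1..int k}. (\<beta> \<bar>\<sigma> j\<bar> = 0 \<longrightarrow> \<sigma> j > 0) \<and>
    (\<forall>i\<in>{1..<j}. \<beta> \<bar>\<sigma> i\<bar> = \<beta> \<bar>\<sigma> j\<bar> \<longrightarrow> (if \<sigma> j > 0 then \<bar>\<sigma> i\<bar> < \<sigma> j else \<bar>\<sigma> j\<bar> < \<bar>\<sigma> i\<bar>)))"
proof (induction k)
  case (Suc k)
  have "\<bar>\<sigma> (int (Suc k))\<bar> \<noteq> \<bar>\<sigma> i\<bar>" if "i \<in> {1..int k}" for i
  proof
    assume "\<bar>\<sigma> (int (Suc k))\<bar> = \<bar>\<sigma> i\<bar>"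
    then have "\<sigma> (int (Suc k)) = \<sigma> i \<or> \<sigma> (int (Suc k)) = \<sigma> (- i)"
      by (auto simp: abs_eq_iff hyperoct_minus[OF s])
    then have "int (Suc k) = i \<or> int (Suc k) = - i" using injD[OF hyperoct_inj[OF s]] by blast
    then show False using that by auto
  qed
  then have notin: "\<bar>\<sigma> (int (Suc k))\<bar> \<notin> abs ` set (rev_word \<sigma> k)"
    unfolding set_rev_word by blast
  have "{1..int (Suc k)} = insert (int (Suc k)) {1..int k}" "{1..<int (Suc k)} = {1..int k}" by auto
  then show ?case
    using Suc notin by (auto simp: set_rev_word simp del: of_nat_Suc)
qed simp

text \<open>Letting \<open>a\<close> be 0, with \<open>inv \<sigma> 0 = 0\<close>, encodes the
  positivity of block 0. For two positive values of one block, the order and signs of their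
  positions translate into the order of the values.\<close>

lemma admissible_iff_inv_increasing:
  assumes s: "\<sigma> \<in> hyperoct n" and \<beta>0: "\<beta> 0 = 0"
  shows "admissible (rev_word \<sigma> n) \<longleftrightarrow>
    (\<forall>a c. 0 \<le> a \<and> a < c \<and> c \<le> int n \<and> \<beta> a = \<beta> c \<longrightarrow> inv \<sigma> a < inv \<sigma> c)"
    (is "_ \<longleftrightarrow> ?inc")
proof
  note ti = hyperoct_inv[OF s]
  have *: "\<bar>inv \<sigma> c\<bar> \<in> {1..int n}" "\<bar>\<sigma> \<bar>inv \<sigma> c\<bar>\<bar> = c"
    "inv \<sigma> c = (if \<sigma> \<bar>inv \<sigma> c\<bar> > 0 then \<bar>inv \<sigma> c\<bar> else - \<bar>inv \<sigma> c\<bar>)" if c: "c \<in> {1..int n}" for c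
  proof -
    show 1: "\<bar>inv \<sigma> c\<bar> \<in> {1..int n}" using hyperoct_abs[OF ti c] .
    show 2: "\<bar>\<sigma> \<bar>inv \<sigma> c\<bar>\<bar> = c"
      using hyperoct_inverse(2)[OF s, of c] hyperoct_minus[OF s, of "inv \<sigma> c"] c
      by (cases "inv \<sigma> c \<ge> 0") auto
    show "inv \<sigma> c = (if \<sigma> \<bar>inv \<sigma> c\<bar> > 0 then \<bar>inv \<sigma> c\<bar> else - \<bar>inv \<sigma> c\<bar>)"
      using inv_abs[OF s, of "\<bar>inv \<sigma> c\<bar>"] 1 2 by auto
  qed
  {
    assume "admissible (rev_word \<sigma> n)"
    then have adm: "(\<beta> \<bar>\<sigma> j\<bar> = 0 \<longrightarrow> \<sigma> j > 0) \<and>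
      (\<forall>i\<in>{1..<j}. \<beta> \<bar>\<sigma> i\<bar> = \<beta> \<bar>\<sigma> j\<bar> \<longrightarrow> (if \<sigma> j > 0 then \<bar>\<sigma> i\<bar> < \<sigma> j else \<bar>\<sigma> j\<bar> < \<bar>\<sigma> i\<bar>))"
      if "j \<in> {1..int n}" for j
      using that admissible_rev_word_iff[OF s] by blast
    show ?inc
    proof (intro allI impI, elim conjE)
      fix a c assume ac: "0 \<le> a" "a < c" "c \<le> int n" "\<beta> a = \<beta> c"
      define j where "j = \<bar>inv \<sigma> c\<bar>"
      have c: "c \<in> {1..int n}" using ac by auto
      note j = *[OF c, folded j_def]
      show "inv \<sigma> a < inv \<sigma> c"
      proof (cases "a = 0")
        case True
        then have "\<sigma> j > 0" using adm[OF j(1)] j(2) ac \<beta>0 by simp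
        then show ?thesis using True hyperoct_0[OF ti] j by simp
      next
        case False
        then have a: "a \<in> {1..int n}" using ac by auto
        define i where "i = \<bar>inv \<sigma> a\<bar>"
        note i = *[OF a, folded i_def]
        have "i \<noteq> j" using i(2) j(2) ac by auto
        \<comment> \<open>Admissibility is applied at the later of the two positions, whose sign
          also decides the order of the signed positions.\<close>
        then consider "i < j" | "j < i" by linarith
        then show ?thesis
        proof cases
          case 1
          then have "i \<in> {1..<j}" "\<beta> \<bar>\<sigma> i\<bar> = \<beta> \<bar>\<sigma> j\<bar>" using i(1,2) j(2) ac by auto
          then have "if \<sigma> j > 0 then \<bar>\<sigma> i\<bar> < \<sigma> j else \<bar>\<sigma> j\<bar> < \<bar>\<sigma> i\<bar>"
            using adm[OF j(1)] by blast
          then have "if \<sigma> j > 0 then a < c else c < a"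
            using i(2) j(2) by (cases "\<sigma> j > 0") simp_all
          then show ?thesis using ac i(1,3) j(1,3) 1 by (auto split: if_splits)
        next
          case 2
          then have "j \<in> {1..<i}" "\<beta> \<bar>\<sigma> j\<bar> = \<beta> \<bar>\<sigma> i\<bar>" using j(1,2) i(2) ac by auto
          then have "if \<sigma> i > 0 then \<bar>\<sigma> j\<bar> < \<sigma> i else \<bar>\<sigma> i\<bar> < \<bar>\<sigma> j\<bar>"
            using adm[OF i(1)] by blast
          then have "if \<sigma> i > 0 then c < a else a < c"
            using i(2) j(2) by (cases "\<sigma> i > 0") simp_all
          then show ?thesis using ac i(1,3) j(1,3) 2 by (auto split: if_splits)
        qed
      qed
    qed
  }
  {
    assume inc: ?inc
    show "admissible (rev_word \<sigma> n)"
      unfolding admissible_rev_word_iff[OF s]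
    proof (intro ballI conjI impI)
      fix j assume j: "j \<in> {1..int n}"
      note cj = hyperoct_abs[OF s j] inv_abs[OF s, of j]
      show "\<sigma> j > 0" if "\<beta> \<bar>\<sigma> j\<bar> = 0"
      proof -
        have "inv \<sigma> 0 < inv \<sigma> \<bar>\<sigma> j\<bar>" using inc[rule_format, of 0 "\<bar>\<sigma> j\<bar>"] cj that \<beta>0 by auto
        then show ?thesis using cj j hyperoct_0[OF ti] by (auto split: if_splits)
      qed
      fix i assume i: "i \<in> {1..<j}" and e: "\<beta> \<bar>\<sigma> i\<bar> = \<beta> \<bar>\<sigma> j\<bar>"
      then have i': "i \<in> {1..int n}" using j by auto
      note ci = hyperoct_abs[OF s i'] inv_abs[OF s, of i]
      have "inv \<sigma> \<bar>\<sigma> i\<bar> \<noteq> inv \<sigma> \<bar>\<sigma> j\<bar>" using ci cj i j by (auto split: if_splits)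
      then have "\<bar>\<sigma> i\<bar> \<noteq> \<bar>\<sigma> j\<bar>" by auto
      then show "if \<sigma> j > 0 then \<bar>\<sigma> i\<bar> < \<sigma> j else \<bar>\<sigma> j\<bar> < \<bar>\<sigma> i\<bar>"
        using inc[rule_format, of "\<bar>\<sigma> i\<bar>" "\<bar>\<sigma> j\<bar>"] inc[rule_format, of "\<bar>\<sigma> j\<bar>" "\<bar>\<sigma> i\<bar>"] ci cj e i j
        by (cases "\<bar>\<sigma> i\<bar>" "\<bar>\<sigma> j\<bar>" rule: linorder_cases) (auto split: if_splits)
    qed
  }
qed

end

section \<open>Proof of the theorem\<close>

theorem theorem3p3:
  fixes n :: nat and M :: "nat set" and q :: "int poly fract"
  defines "q \<equiv> indet"
  assumes "n \<ge> 1" and "M \<subseteq> {0..n - 1}"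
  shows "(\<Sum>\<sigma> | \<sigma> \<in> hyperoct n \<and> Des_B n (inv \<sigma>) \<subseteq> M. q ^ len_B n \<sigma>)
           = (\<Sum>\<sigma> | \<sigma> \<in> hyperoct n \<and> Des_B n (inv \<sigma>) \<subseteq> M. q ^ fmaj n \<sigma>)
       \<and> (\<Sum>\<sigma> | \<sigma> \<in> hyperoct n \<and> Des_B n (inv \<sigma>) \<subseteq> M. q ^ fmaj n \<sigma>)
           = q_multinomial q n (\<Delta> n M) * (\<Prod>j = cut_point n M 1 + 1..n. 1 + q ^ j)"
proof -

  \<comment> \<open>Blocks cut out by \<open>M\<close> and the descent condition\<close>
  have finM: "finite M" using assms(3) finite_subset by blast
  have Mn: "m < n" if "m \<in> M" for m using that assms(2,3) by fastforce
  \<comment> \<open>Only cuts strictly below \<open>a\<close> count, so a cut is the last element of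
    its block. If 0 is in \<open>M\<close>, block 0 has no positive element.\<close>
  define cnt where "cnt a = {m \<in> M. int m < a}" for a
  define \<beta> where "\<beta> a = int (card (cnt a))" for a
  have fin_cnt: "finite (cnt a)" for a using finM by (simp add: cnt_def)
  interpret signed_blocks \<beta> "int (card M)" q
  proof
    show "mono \<beta>"
      by (rule monoI) (auto simp: \<beta>_def cnt_def finM intro!: card_mono)
    show "0 \<le> \<beta> a" for a by (simp add: \<beta>_def)
    show "\<beta> a \<le> int (card M)" for a using card_mono[OF finM, of "cnt a"] by (auto simp: \<beta>_def cnt_def)
    show "q ^ k \<noteq> 1" if "k > 0" for k using indet_power_neq_1[OF that] by (simp add: q_def)
  qed
  have \<beta>0: "\<beta> 0 = 0" by (simp add: \<beta>_def cnt_def)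
  have \<beta>_step: "\<beta> (int i) = \<beta> (int i + 1) \<longleftrightarrow> i \<notin> M" for i
  proof -
    have "cnt (int i + 1) = (if i \<in> M then insert i (cnt (int i)) else cnt (int i))"
      by (auto simp: cnt_def le_less)
    moreover have "i \<notin> cnt (int i)" by (simp add: cnt_def)
    ultimately show ?thesis using fin_cnt by (simp add: \<beta>_def)
  qed
  have des: "Des_B n (inv \<sigma>) \<subseteq> M \<longleftrightarrow> admissible (rev_word \<sigma> n)" if s: "\<sigma> \<in> hyperoct n" for \<sigma>
  proof -
    define \<tau> where "\<tau> = inv \<sigma>"
    have t: "\<tau> \<in> hyperoct n" using hyperoct_inv[OF s] by (simp add: \<tau>_def)
    have ne: "\<tau> (int i) \<noteq> \<tau> (int i + 1)" for i
      using injD[OF hyperoct_inj[OF t], of "int i" "int i + 1"] by auto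
    have "Des_B n \<tau> \<subseteq> M \<longleftrightarrow> (\<forall>i<n. i \<notin> M \<longrightarrow> \<tau> (int i) < \<tau> (int i + 1))"
      using ne by (auto simp: Des_B_eq[OF t] not_less order_less_le)
    also have "\<dots> \<longleftrightarrow> (\<forall>a c. 0 \<le> a \<and> a < c \<and> c \<le> int n \<and> \<beta> a = \<beta> c \<longrightarrow> \<tau> a < \<tau> c)"
      (is "?L \<longleftrightarrow> ?R")
    proof
      assume ?R
      then show ?L using \<beta>_step by auto
    next
      assume L: ?L
      \<comment> \<open>Adjacent comparisons are chained: as \<beta> is monotone, equal block
        numbers at both ends leave no cut in between.\<close>
      have "\<tau> (int a) < \<tau> (int a + 1 + int d)"
        if "a + 1 + d \<le> n" "\<beta> (int a) = \<beta> (int a + 1 + int d)" for a d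
        using that
      proof (induction d)
        case 0
        then show ?case using L \<beta>_step[of a] by simp
      next
        case (Suc d)
        let ?c = "a + 1 + d"
        have eqd: "int a + 1 + int d = int ?c" by simp
        have "\<beta> (int a) \<le> \<beta> (int ?c)" "\<beta> (int ?c) \<le> \<beta> (int ?c + 1)"
          using mono_\<beta> by (auto intro!: monoD[of \<beta>])
        moreover have eqc: "int a + 1 + int (Suc d) = int ?c + 1" by simp
        ultimately have e: "\<beta> (int a) = \<beta> (int ?c)" "\<beta> (int ?c) = \<beta> (int ?c + 1)"
          using Suc.prems(2) unfolding eqc by linarith+
        have "\<tau> (int ?c) < \<tau> (int ?c + 1)" using L[rule_format, of ?c] e(2) \<beta>_step[of ?c] Suc.prems(1) by simp
        moreover have "\<tau> (int a) < \<tau> (int ?c)" 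
          using Suc.IH e(1) Suc.prems(1) by (simp only: eqd)
        ultimately show ?case unfolding eqc by linarith
      qed
      note step = this
      show ?R
      proof (intro allI impI, elim conjE)
        fix a c :: int assume "0 \<le> a" "a < c" "c \<le> int n" "\<beta> a = \<beta> c"
        then show "\<tau> a < \<tau> c" using step[of "nat a" "nat (c - a - 1)"] by (simp add: nat_le_iff)
      qed
    qed
    finally show ?thesis using admissible_iff_inv_increasing[OF s \<beta>0] by (simp add: \<tau>_def)
  qed

  \<comment> \<open>Transfer of both sums to words\<close>
  define S where "S = {\<sigma>. \<sigma> \<in> hyperoct n \<and> Des_B n (inv \<sigma>) \<subseteq> M}"
  define A where "A = {1..int n}"
  have A: "finite A" "A \<subseteq> {0<..}" by (auto simp: A_def)
  have bij: "bij_betw (\<lambda>\<sigma>. rev_word \<sigma> n) S (shuffles_of A)"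
    unfolding bij_betw_def
  proof
    show "inj_on (\<lambda>\<sigma>. rev_word \<sigma> n) S"
      by (rule inj_on_subset[OF inj_on_rev_word]) (auto simp: S_def)
    show "(\<lambda>\<sigma>. rev_word \<sigma> n) ` S = shuffles_of A"
    proof
      show "(\<lambda>\<sigma>. rev_word \<sigma> n) ` S \<subseteq> shuffles_of A"
      proof (rule image_subsetI)
        fix \<sigma> assume "\<sigma> \<in> S"
        then have "\<sigma> \<in> hyperoct n" "Des_B n (inv \<sigma>) \<subseteq> M" by (auto simp: S_def)
        then show "rev_word \<sigma> n \<in> shuffles_of A"
          using des[of \<sigma>] abs_set_rev_word[of \<sigma> n] by (simp add: shuffles_of_def A_def)
      qed
      show "shuffles_of A \<subseteq> (\<lambda>\<sigma>. rev_word \<sigma> n) ` S"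
      proof
        fix w assume "w \<in> shuffles_of A"
        then have w: "admissible w" "abs ` set w = {1..int n}" by (auto simp: shuffles_of_def A_def)
        then obtain \<sigma> where "\<sigma> \<in> hyperoct n" "rev_word \<sigma> n = w"
          using exists_hyperoct_rev_word admissible_imp_distinct by metis
        then show "w \<in> (\<lambda>\<sigma>. rev_word \<sigma> n) ` S" using des w(1) by (auto simp: S_def)
      qed
    qed
  qed
  have len: "(\<Sum>\<sigma>\<in>S. q ^ len_B n \<sigma>) = F A"
  proof -
    have "(\<Sum>\<sigma>\<in>S. q ^ len_B n \<sigma>) = (\<Sum>\<sigma>\<in>S. q ^ len_word (rev_word \<sigma> n))"
      using card_invs_eq_len_word hyperoct_inj hyperoct_minus
      by (intro sum.cong refl) (auto simp: S_def len_B_eq)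
    then show ?thesis using sum.reindex_bij_betw[OF bij, of "\<lambda>w. q ^ len_word w"]
      sum_len_word[OF A] by simp
  qed
  have maj: "(\<Sum>\<sigma>\<in>S. q ^ fmaj n \<sigma>) = F A"
    unfolding fmaj_eq_fmaj_word using sum.reindex_bij_betw[OF bij, of "\<lambda>w. q ^ fmaj_word w"]
      sum_fmaj_word[OF A] by simp

  \<comment> \<open>Block sizes and cut points\<close>
  define d where "d b = cut_point n M (b + 1) - cut_point n M b" for b
  define xs where "xs = sorted_list_of_set M"
  have xs: "sorted_wrt (<) xs" "set xs = M" "length xs = card M"
    using finM by (auto simp: xs_def)
  have cut0: "cut_point n M 0 = 0" by (simp add: cut_point_def)
  \<comment> \<open>The leading 0 shifts the index by one, and the final \<open>n\<close> closes the
    last block.\<close>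
  have cutS: "cut_point n M (Suc b) = (if b < card M then xs ! b else n)" if "b \<le> card M" for b
    using that xs(3) by (auto simp: cut_point_def nth_append simp flip: xs_def)
  have cut_le: "cut_point n M (Suc b) \<le> n" if "b \<le> card M" for b
    using that Mn[of "xs ! b"] xs nth_mem[of b xs] by (auto simp: cutS)
  have \<beta>_le: "\<beta> a \<le> int b \<longleftrightarrow> a \<le> int (cut_point n M (Suc b))" if "b \<le> card M" "a \<in> A" for a b
  proof -
    have "cnt a = {m \<in> set xs. m < nat a}" using that by (auto simp: cnt_def xs A_def)
    then have "\<beta> a \<le> int b \<longleftrightarrow> card M \<le> b \<or> nat a \<le> xs ! b"
      using card_less_le_iff[OF xs(1), of "nat a" b] xs by (simp add: \<beta>_def)
    then show ?thesis using that by (auto simp: cutS A_def)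
  qed
  have card_blk: "card (blk A (int b)) = d b" if b: "b \<le> card M" for b
  proof -
    have "a \<in> blk A (int b) \<longleftrightarrow> a \<in> {int (cut_point n M b) + 1..int (cut_point n M (Suc b))}" for a
    proof (cases "a \<in> A")
      case True
      have "\<not> \<beta> a \<le> int b - 1 \<longleftrightarrow> int (cut_point n M b) + 1 \<le> a"
      proof (cases b)
        case 0
        then show ?thesis using True \<beta>_bounds(1)[of a] by (auto simp: cut0 A_def)
      next
        case (Suc b')
        then show ?thesis using \<beta>_le[of b' a] b True by auto
      qed
      then show ?thesis using \<beta>_le[OF b True] True by (auto simp: blk_def)
    next
      case False
      then show ?thesis using cut_le[OF b] by (auto simp: blk_def A_def)
    qed
    then have "blk A (int b) = {int (cut_point n M b) + 1..int (cut_point n M (Suc b))}" by blast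
    then show ?thesis by (simp add: d_def)
  qed
  \<comment> \<open>This makes the powers of \<open>1 - q\<close> in the q-multinomial coefficient
    cancel.\<close>
  have sum_d: "(\<Sum>b = 0..card M. d b) = n"
  proof -
    have "(\<Sum>b = 0..card M. d b) = (\<Sum>b\<in>{0..card M}. \<Sum>a\<in>{a \<in> A. nat (\<beta> a) = b}. 1)"
    proof (rule sum.cong[OF refl])
      fix b assume "b \<in> {0..card M}"
      moreover have "{a \<in> A. nat (\<beta> a) = b} = blk A (int b)"
        by (auto simp: blk_def \<beta>_def)
      ultimately show "d b = (\<Sum>a\<in>{a \<in> A. nat (\<beta> a) = b}. 1)" using card_blk by simp
    qed
    also have "\<dots> = (\<Sum>a\<in>A. 1)"
      using \<beta>_bounds A(1) by (intro sum.group) (auto simp: nat_le_iff)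
    finally show ?thesis by (simp add: A_def)
  qed
  \<comment> \<open>\<open>P1 m\<close> is the q-factorial of \<open>m\<close> without its
    denominator \<open>(1 - q) ^ m\<close>.\<close>
  define P1 where "P1 m = (\<Prod>j = 1..m. 1 - q ^ j)" for m
  define N where "N m = (\<Prod>j = 1..m. 1 + q ^ j)" for m
  have P2: "(\<Prod>j = 1..m. 1 - q ^ (2 * j)) = P1 m * N m" for m
    unfolding P1_def N_def by (rule prod_one_minus_power_double)
  \<comment> \<open>\<open>N m\<close> is a factor of a product of nonzero terms
    \<open>1 - q ^ (2 * j)\<close>.\<close>
  have N0: "N m \<noteq> 0" for m
  proof -
    have "P1 m * N m \<noteq> 0"
      unfolding P2[symmetric] using q_power_neq_1[of "2 * _"] by (subst prod_zero_iff) auto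
    then show ?thesis by simp
  qed
  have q1: "1 - q \<noteq> 0" using q_power_neq_1[of 1] by simp
  have blocks: "(\<Prod>b\<in>{0..int (card M)}. block_fact b (card (blk A b)))
    = (\<Prod>b = 0..card M. P1 (d b)) * N (d 0)"
  proof -
    have "(\<Prod>b\<in>{0..int (card M)}. block_fact b (card (blk A b)))
      = (\<Prod>b = 0..card M. block_fact (int b) (card (blk A (int b))))"
      by (rule prod.reindex_bij_witness[of _ int nat]) auto
    also have "\<dots> = (\<Prod>b = 0..card M. P1 (d b) * (if b = 0 then N (d 0) else 1))"
    proof (rule prod.cong[OF refl])
      fix b assume "b \<in> {0..card M}"
      moreover have "block_fact (int b) m = P1 m * (if b = 0 then N m else 1)" for m
        using P2[of m] by (simp add: block_fact_def P1_def)
      ultimately show "block_fact (int b) (card (blk A (int b)))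
          = P1 (d b) * (if b = 0 then N (d 0) else 1)"
        using card_blk[of b] by simp
    qed
    also have "\<dots> = (\<Prod>b = 0..card M. P1 (d b)) * N (d 0)"
      by (simp add: prod.distrib prod.delta)
    finally show ?thesis .
  qed
  \<comment> \<open>The factor \<open>N (d 0)\<close> from block 0 cancels the factors of
    \<open>N n\<close> up to the first cut point.\<close>
  have "cut_point n M 1 = d 0" by (simp add: d_def cut0)
  moreover have "d 0 \<le> n" using cut_le[of 0] by (simp add: d_def cut0)
  ultimately have N: "N n = N (d 0) * (\<Prod>j = cut_point n M 1 + 1..n. 1 + q ^ j)"
    unfolding N_def using prod.ub_add_nat[of 1 "d 0" "\<lambda>j. 1 + q ^ j" "n - d 0"] by simp
  have q_fact: "q_fact q m = P1 m / (1 - q) ^ m" for m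
    unfolding q_fact_eq P1_def ..
  have "prod_list (map (q_fact q) (\<Delta> n M)) = prod_list (map (\<lambda>b. q_fact q (d b)) [0..<card M + 1])"
    by (simp add: \<Delta>_def o_def d_def)
  also have "\<dots> = (\<Prod>b\<in>set [0..<card M + 1]. q_fact q (d b))"
    by (rule prod.distinct_set_conv_list[symmetric]) simp
  also have "\<dots> = (\<Prod>b = 0..card M. q_fact q (d b))"
    by (rule prod.cong) auto
  also have "\<dots> = (\<Prod>b = 0..card M. P1 (d b)) / (1 - q) ^ n"
    unfolding q_fact prod_dividef power_sum[symmetric] sum_d ..
  finally have "q_multinomial q n (\<Delta> n M) = P1 n / (\<Prod>b = 0..card M. P1 (d b))"
    using q1 by (simp add: q_multinomial_def q_fact)
  then have "F A = q_multinomial q n (\<Delta> n M) * (\<Prod>j = cut_point n M 1 + 1..n. 1 + q ^ j)"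
    unfolding F_def blocks P2 using N N0[of "d 0"] by (simp add: A_def)
  then show ?thesis using len maj unfolding S_def by simp
qed

end
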